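(* For every $k\ge 2$, $\ell\ge 1$ and every $\delta\in[0,1)$, $$\mathsf{PIC}_{\zeta_\ell,\delta}(\mathsf{Disj}_\ell)\ \ge\ (\ell-1)\cdot \mathsf{PIC}_{\zeta_2,\delta}(\mathsf{Disj}_2).$$
   Context: Coordinator model: $k$ processors and a coordinator; input a $k\times \ell$ Boolean matrix $X$, processor $i$ privately holds row $X^i$, the coordinator has no input, each processor has a private channel only to the coordinator, all parties have private coins. A protocol is $\delta$-error for $f$ if on every input it is correct with probability at least $1-\delta$. $\Pi^i(X)$ denotes processor $i$'s view of the transcript (the messages exchanged between processor $i$ and the coordinator). $\mathsf{Disj}_\ell(A)=1$ iff some column of the $k\times\ell$ Boolean matrix $A$ is all ones. Distribution $\zeta_\ell$ on $(\mathbf X,\mathbf M,\mathbf Z,\mathbf W)$, $\mathbf X\in\{0,1\}^{k\times\ell}$, $\mathbf M\in\{0,1\}^\ell$, $\mathbf Z\in[k]^\ell$, $\mathbf W\in[\ell]$: independently for each column $t$, $\Pr[\mathbf M_t=1]=1/3$, $\mathbf Z_t$ uniform in $[k]$; processor $\mathbf Z_t$'s entry in column $t$ is $0$, every other entry of column $t$ is $1$ if $\mathbf M_t=1$ and an independent uniform bit if $\mathbf M_t=0$; then $\mathbf W$ is uniform in $[\ell]$ and column $\mathbf W$ of $\mathbf X$ is overwritten by all ones. Partial information cost: $\mathbf M_{-\mathbf W}$ is $\mathbf M$ with coordinate $\mathbf W$ removed, $\mathbf X^i_{-\mathbf W}$ is row $\mathbf X^i$ with coordinate $\mathbf W$ removed,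 and $$\mathsf{PIC}_{\zeta_\ell}(\Pi)=\sum_{i=1}^k\Big(\mathbb I[\mathbf M_{-\mathbf W}:\Pi^i(\mathbf X)\mid \mathbf X^i,\mathbf Z,\mathbf W]+\mathbb I[\mathbf X^i_{-\mathbf W}:\Pi^i(\mathbf X)\mid \mathbf M,\mathbf Z,\mathbf W]\Big);$$ $\mathsf{PIC}_{\zeta_\ell,\delta}(\mathsf{Disj}_\ell)$ is the infimum of $\mathsf{PIC}_{\zeta_\ell}(\Pi)$ over $\delta$-error protocols $\Pi$ for $\mathsf{Disj}_\ell$. *)

theory Defs
  imports "HOL-Probability.Probability" "HOL-Probability.Product_PMF"
begin

text \<open>
  Processors are numbered \<open>0..<k\<close> and columns \<open>0..<l\<close>. A \<open>k \<times> l\<close> Boolean matrix is a function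
  \<open>X\<close> (row, then column) that is \<open>False\<close> outside the index range, so that every matrix has
  exactly one representation.
\<close>

type_synonym matrix = "nat \<Rightarrow> nat \<Rightarrow> bool"

definition matrices :: "nat \<Rightarrow> nat \<Rightarrow> matrix set" where
  "matrices k l = {X. \<forall>i t. X i t \<longrightarrow> i < k \<and> t < l}"

definition Disj :: "nat \<Rightarrow> nat \<Rightarrow> matrix \<Rightarrow> bool" where
  "Disj k l X \<longleftrightarrow> (\<exists>t<l. \<forall>i<k. X i t)"


section \<open>The coordinator model\<close>

text \<open>
  Communication is driven by the coordinator: as long as it has not halted, it picks a processor
  \<open>i\<close>, sends it a message, and receives a reply. A triple \<open>(i, m, m')\<close> in a history records that
  processor \<open>i\<close> was sent \<open>m\<close> and answered \<open>m'\<close>; either message may be empty.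
\<close>

type_synonym message = "bool list"
type_synonym history = "(nat \<times> message \<times> message) list"

datatype action = Send nat message | Halt bool

text \<open>
  Each party draws its private coins once, before the execution, from an arbitrary discrete
  distribution. As the communication is bounded (see \<open>is_protocol\<close> below), more general coin
  spaces would give no further protocols up to equality of the transcript distributions.
\<close>

record protocol =
  coord_coins :: "nat pmf"
  proc_coins :: "nat \<Rightarrow> nat pmf"
  coord_act :: "nat \<Rightarrow> history \<Rightarrow> action"
    \<comment> \<open>own coins, history so far\<close>
  proc_reply :: "nat \<Rightarrow> (nat \<Rightarrow> bool) \<Rightarrow> nat \<Rightarrow> (message \<times> message) list \<Rightarrow> message \<Rightarrow> message"
    \<comment> \<open>processor, its row, its coins, its view so far, the message just received\<close>
  max_rounds :: nat

definition view :: "nat \<Rightarrow> history \<Rightarrow> (message \<times> message) list" where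
  "view i h = map snd (filter (\<lambda>e. fst e = i) h)"

primrec history_upto :: "protocol \<Rightarrow> matrix \<Rightarrow> nat \<Rightarrow> (nat \<Rightarrow> nat) \<Rightarrow> nat \<Rightarrow> history" where
  "history_upto P X c r 0 = []"
| "history_upto P X c r (Suc n) =
    (let h = history_upto P X c r n in
     case coord_act P c h of
       Halt b \<Rightarrow> h
     | Send i m \<Rightarrow> h @ [(i, m, proc_reply P i (X i) (r i) (view i h) m)])"

definition transcript :: "protocol \<Rightarrow> matrix \<Rightarrow> nat \<Rightarrow> (nat \<Rightarrow> nat) \<Rightarrow> history" where
  "transcript P X c r = history_upto P X c r (max_rounds P)"

definition is_protocol :: "nat \<Rightarrow> nat \<Rightarrow> protocol \<Rightarrow> bool" where
  "is_protocol k l P \<longleftrightarrow>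
     (\<exists>B. \<forall>X \<in> matrices k l. \<forall>c \<in> set_pmf (coord_coins P).
        \<forall>r. (\<forall>i<k. r i \<in> set_pmf (proc_coins P i)) \<longrightarrow>
          (\<exists>b. coord_act P c (transcript P X c r) = Halt b) \<and>
          (\<forall>(i, m, m') \<in> set (transcript P X c r). i < k \<and> length m \<le> B \<and> length m' \<le> B))"

text \<open>Joint distribution of the full transcript and of the coordinator's final action on input \<open>X\<close>.\<close>

definition run :: "nat \<Rightarrow> protocol \<Rightarrow> matrix \<Rightarrow> (history \<times> action) pmf" where
  "run k P X =
     do { c \<leftarrow> coord_coins P;
          r \<leftarrow> Pi_pmf {..<k} 0 (proc_coins P);
          return_pmf (let h = transcript P X c r in (h, coord_act P c h)) }"

definition delta_error_protocols :: "real \<Rightarrow> nat \<Rightarrow> nat \<Rightarrow> (matrix \<Rightarrow> bool) \<Rightarrow> protocol set" where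
  "delta_error_protocols \<delta> k l f =
     {P. is_protocol k l P \<and>
         (\<forall>X \<in> matrices k l.
            measure_pmf.prob (run k P X) {(h, a). a = Halt (f X)} \<ge> 1 - \<delta>)}"


section \<open>The input distribution\<close>

definition zeta_column :: "nat \<Rightarrow> (bool \<times> nat \<times> (nat \<Rightarrow> bool)) pmf" where
  "zeta_column k =
     do { m \<leftarrow> bernoulli_pmf (1/3);
          z \<leftarrow> pmf_of_set {..<k};
          x \<leftarrow> Pi_pmf {..<k} False
                (\<lambda>i. if i = z then return_pmf False
                     else if m then return_pmf True
                     else bernoulli_pmf (1/2));
          return_pmf (m, z, x) }"

text \<open>Outside \<open>{..<l}\<close>, \<open>M\<close> and \<open>Z\<close> take the dummy values \<open>False\<close> and \<open>0\<close>.\<close>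

definition zeta :: "nat \<Rightarrow> nat \<Rightarrow> (matrix \<times> (nat \<Rightarrow> bool) \<times> (nat \<Rightarrow> nat) \<times> nat) pmf" where
  "zeta k l =
     do { C \<leftarrow> Pi_pmf {..<l} (False, 0, \<lambda>_. False) (\<lambda>_. zeta_column k);
          w \<leftarrow> pmf_of_set {..<l};
          return_pmf
            (\<lambda>i t. if t = w then i < k else snd (snd (C t)) i,
             \<lambda>t. fst (C t),
             \<lambda>t. fst (snd (C t)),
             w) }"


section \<open>Partial information cost\<close>

text \<open>
  Conditional mutual information (in bits) of discrete random variables on the probability space
  \<open>p\<close>. The space is cut down to the support of \<open>p\<close> because \<open>space (measure_pmf p)\<close> is the whole
  type, on which the random variables below would have uncountable range.
\<close>

definition cond_mutual_info :: "'a pmf \<Rightarrow> ('a \<Rightarrow> 'b) \<Rightarrow> ('a \<Rightarrow> 'c) \<Rightarrow> ('a \<Rightarrow> 'd) \<Rightarrow> real" where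
  "cond_mutual_info p A B C =
     prob_space.conditional_mutual_information (restrict_space (measure_pmf p) (set_pmf p)) 2
       (count_space (A ` set_pmf p)) (count_space (B ` set_pmf p)) (count_space (C ` set_pmf p))
       A B C"

definition drop_coord :: "nat \<Rightarrow> nat \<Rightarrow> (nat \<Rightarrow> 'a) \<Rightarrow> (nat \<Rightarrow> 'a)" where
  "drop_coord l w v = restrict v ({..<l} - {w})"

definition joint ::
  "nat \<Rightarrow> nat \<Rightarrow> protocol \<Rightarrow> (matrix \<times> (nat \<Rightarrow> bool) \<times> (nat \<Rightarrow> nat) \<times> nat \<times> history) pmf" where
  "joint k l P =
     do { (X, M, Z, W) \<leftarrow> zeta k l;
          (h, a) \<leftarrow> run k P X;
          return_pmf (X, M, Z, W, h) }"

definition PIC :: "nat \<Rightarrow> nat \<Rightarrow> protocol \<Rightarrow> real" where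
  "PIC k l P =
     (\<Sum>i<k.
        cond_mutual_info (joint k l P)
          (\<lambda>(X, M, Z, W, h). drop_coord l W M)
          (\<lambda>(X, M, Z, W, h). view i h)
          (\<lambda>(X, M, Z, W, h). (X i, Z, W))
      + cond_mutual_info (joint k l P)
          (\<lambda>(X, M, Z, W, h). drop_coord l W (X i))
          (\<lambda>(X, M, Z, W, h). view i h)
          (\<lambda>(X, M, Z, W, h). (M, Z, W)))"

definition PIC_inf :: "real \<Rightarrow> nat \<Rightarrow> nat \<Rightarrow> (matrix \<Rightarrow> bool) \<Rightarrow> ereal" where
  "PIC_inf \<delta> k l f = (INF P \<in> delta_error_protocols \<delta> k l f. ereal (PIC k l P))"

end

theory Submission
  imports Defs
begin

text \<open>
  Fix a protocol for \<open>l\<close> columns and an ordered pair \<open>s \<noteq> t\<close>. A protocol for two columns places its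
  input at columns \<open>s\<close> and \<open>t\<close> and fills in the other columns as in \<open>zeta_column\<close>. The coordinator
  samples them and tells processor \<open>i\<close> the pairs \<open>(M\<^sub>j, Z\<^sub>j)\<close> for \<open>j\<close> in a set \<open>A\<close> and its own entries
  for \<open>j \<notin> A\<close>; the entries for \<open>j \<in> A\<close> each processor draws privately given \<open>M\<^sub>j\<close> and \<open>Z\<^sub>j\<close>.
  No sampled column is all ones, so the error is preserved. Given that \<open>s\<close> is the planted column, the
  cost of the new protocol is at most the sum over \<open>i\<close> of
  \<open>I[M\<^sub>t : \<Pi>\<^sup>i | M\<^sub>A, X\<^sup>i, Z] + I[X\<^sup>i\<^sub>t : \<Pi>\<^sup>i | X\<^sup>i\<^sub>B, M, Z]\<close>, where \<open>B\<close> is the complement of \<open>A \<union> {s, t}\<close>,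
  because the columns outside \<open>{s, t}\<close> are independent of those two. If \<open>A\<close> is the set of predecessors
  of \<open>t\<close> in some order of the columns other than \<open>s\<close>, these are the terms of the two chain rules for
  the cost of the given protocol. Choosing \<open>A\<close> as the cyclic interval strictly between \<open>s\<close> and \<open>t\<close>
  serves both planted columns at once: it precedes \<open>t\<close> in the cyclic order starting at \<open>s\<close>, and it
  precedes \<open>s\<close> in the reversed cyclic order starting at \<open>t\<close>. Summing over the \<open>l (l - 1)\<close> ordered pairs
  gives \<open>l\<close> times the cost of the given protocol.
\<close>

section \<open>Entropy and conditional mutual information\<close>

definition pmf_entropy :: "'a pmf \<Rightarrow> real" where
  "pmf_entropy p = measure_pmf.expectation p (\<lambda>x. - log 2 (pmf p x))"

lemma pmf_map_pos: "x \<in> set_pmf p \<Longrightarrow> 0 < pmf (map_pmf f p) (f x)"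
  by (simp add: pmf_positive)

lemma pmf_entropy_map:
  "pmf_entropy (map_pmf f p) = measure_pmf.expectation p (\<lambda>x. - log 2 (pmf (map_pmf f p) (f x)))"
  by (simp add: pmf_entropy_def)

lemma pmf_entropy_map_cong:
  assumes "\<And>x y. x \<in> set_pmf p \<Longrightarrow> y \<in> set_pmf p \<Longrightarrow> f x = f y \<longleftrightarrow> g x = g y"
  shows "pmf_entropy (map_pmf f p) = pmf_entropy (map_pmf g p)"
  unfolding pmf_entropy_map
proof (intro integral_cong_AE AE_pmfI)
  fix x assume "x \<in> set_pmf p"
  then have "pmf (map_pmf f p) (f x) = pmf (map_pmf g p) (g x)"
    unfolding pmf_map using assms by (intro measure_prob_cong_0) (auto simp: set_pmf_eq)
  then show "- log 2 (pmf (map_pmf f p) (f x)) = - log 2 (pmf (map_pmf g p) (g x))"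
    by simp
qed simp_all

lemma pmf_bind_tagged: "pmf (bind_pmf m (\<lambda>w. map_pmf (\<lambda>a. (a, w)) (q w))) (a, w)
    = pmf (q w) a * pmf m w"
proof -
  have "pmf (map_pmf (\<lambda>a. (a, v)) (q v)) (a, w) = (if v = w then pmf (q w) a else 0)" for v
    by (auto simp: pmf_map vimage_def measure_pmf_single)
  then have "pmf (bind_pmf m (\<lambda>w. map_pmf (\<lambda>a. (a, w)) (q w))) (a, w)
      = measure_pmf.expectation m (\<lambda>v. pmf (q w) a * indicator {w} v)"
    unfolding pmf_bind
    by (intro arg_cong[where f = "measure_pmf.expectation m"]) (auto simp: fun_eq_iff)
  then show ?thesis
    by (simp add: measure_pmf_single)
qed

lemma pmf_entropy_bind_tagged:
  assumes finite_m: "finite (set_pmf m)" and finite_q: "\<And>w. w \<in> set_pmf m \<Longrightarrow> finite (set_pmf (q w))"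
  shows "pmf_entropy (bind_pmf m (\<lambda>w. map_pmf (\<lambda>a. (a, w)) (q w)))
    = pmf_entropy m + measure_pmf.expectation m (\<lambda>w. pmf_entropy (q w))"
proof -
  have "measure_pmf.expectation (q w) (\<lambda>a. - log 2 (pmf (q w) a * pmf m w))
      = - log 2 (pmf m w) + pmf_entropy (q w)"
    if w_in: "w \<in> set_pmf m" for w
  proof -
    have "measure_pmf.expectation (q w) (\<lambda>a. - log 2 (pmf (q w) a * pmf m w))
        = measure_pmf.expectation (q w) (\<lambda>a. - log 2 (pmf m w) + - log 2 (pmf (q w) a))"
      using w_in by (intro integral_cong_AE AE_pmfI) (auto simp: log_mult set_pmf_eq)
    also have "\<dots> = - log 2 (pmf m w) + pmf_entropy (q w)"
      using finite_q[OF w_in]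
      by (simp add: pmf_entropy_def integrable_measure_pmf_finite
          del: add_uminus_conv_diff Bochner_Integration.integral_minus)
    finally show ?thesis .
  qed
  moreover have "pmf_entropy (bind_pmf m (\<lambda>w. map_pmf (\<lambda>a. (a, w)) (q w)))
      = (\<Sum>w\<in>set_pmf m. pmf m w *\<^sub>R measure_pmf.expectation (q w) (\<lambda>a. - log 2 (pmf (q w) a * pmf m w)))"
    unfolding pmf_entropy_def pmf_bind_tagged using finite_m finite_q
    by (subst pmf_expectation_bind[OF finite_m]) (simp_all add: pmf_bind_tagged)
  ultimately have "pmf_entropy (bind_pmf m (\<lambda>w. map_pmf (\<lambda>a. (a, w)) (q w)))
      = (\<Sum>w\<in>set_pmf m. pmf m w *\<^sub>R (- log 2 (pmf m w) + pmf_entropy (q w)))"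
    by simp
  also have "\<dots> = measure_pmf.expectation m (\<lambda>w. - log 2 (pmf m w) + pmf_entropy (q w))"
    by (rule integral_measure_pmf[OF finite_m, symmetric])
  also have "\<dots> = pmf_entropy m + measure_pmf.expectation m (\<lambda>w. pmf_entropy (q w))"
    unfolding pmf_entropy_def
    by (intro Bochner_Integration.integral_add integrable_measure_pmf_finite finite_m)
  finally show ?thesis .
qed

lemma pmf_entropy_pair:
  assumes "finite (set_pmf p)" "finite (set_pmf q)"
  shows "pmf_entropy (pair_pmf p q) = pmf_entropy p + pmf_entropy q"
proof -
  have "pair_pmf p q = bind_pmf q (\<lambda>y. map_pmf (\<lambda>x. (x, y)) p)"
    unfolding pair_pmf_def map_pmf_def by (rule bind_commute_pmf)
  then show ?thesis
    using pmf_entropy_bind_tagged[of q "\<lambda>_. p"] assms by simp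
qed

lemma information_space_restrict_set_pmf:
  "information_space (restrict_space (measure_pmf p) (set_pmf p)) 2"
proof -
  have "emeasure (measure_pmf p) (set_pmf p) = 1"
    using measure_pmf.emeasure_eq_1_AE[of "set_pmf p" p] by (auto intro: AE_pmfI)
  then interpret prob_space "restrict_space (measure_pmf p) (set_pmf p)"
    by (intro prob_spaceI) (simp add: emeasure_restrict_space space_restrict_space)
  show ?thesis
    by unfold_locales simp
qed

context
  fixes p :: "'a pmf"
  assumes finite_p: "finite (set_pmf p)"
begin

lemma simple_function_restrict_set_pmf:
  "simple_function (restrict_space (measure_pmf p) (set_pmf p)) f"
  using finite_p by (auto simp: simple_function_def space_restrict_space sets_restrict_space)

lemma simple_distributed_restrict_set_pmf:
  "simple_distributed (restrict_space (measure_pmf p) (set_pmf p)) f (pmf (map_pmf f p))"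
proof -
  let ?M = "restrict_space (measure_pmf p) (set_pmf p)"
  interpret information_space ?M 2
    by (rule information_space_restrict_set_pmf)
  have "measure ?M (f -` {v} \<inter> space ?M) = pmf (map_pmf f p) v" for v
    by (auto simp: measure_restrict_space space_restrict_space pmf_map set_pmf_eq
        intro: measure_prob_cong_0)
  then show ?thesis
    by (intro simple_distributedI simple_function_restrict_set_pmf) simp_all
qed

lemma cond_mutual_info_eq_entropy:
  "cond_mutual_info p A B C
   = pmf_entropy (map_pmf (\<lambda>x. (A x, C x)) p) + pmf_entropy (map_pmf (\<lambda>x. (B x, C x)) p)
   - pmf_entropy (map_pmf (\<lambda>x. (A x, B x, C x)) p) - pmf_entropy (map_pmf C p)"
proof -
  interpret information_space "restrict_space (measure_pmf p) (set_pmf p)" 2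
    by (rule information_space_restrict_set_pmf)
  let ?ABC = "\<lambda>x. (A x, B x, C x)" and ?AC = "\<lambda>x. (A x, C x)" and ?BC = "\<lambda>x. (B x, C x)"
  let ?P = "\<lambda>f. pmf (map_pmf f p)"
  let ?ratio = "\<lambda>(a, b, c). log 2 (?P ?ABC (a, b, c) / (?P ?AC (a, c) * (?P ?BC (b, c) / ?P C c)))"
  note space_restrict_space [simp]
  have "cond_mutual_info p A B C = (\<Sum>v\<in>set_pmf (map_pmf ?ABC p). ?P ?ABC v *\<^sub>R ?ratio v)"
    unfolding cond_mutual_info_def
    using conditional_mutual_information_eq[OF simple_distributed_restrict_set_pmf
        simple_distributed_restrict_set_pmf simple_distributed_restrict_set_pmf
        simple_distributed_restrict_set_pmf]
    by (simp add: case_prod_unfold)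
  also have "\<dots> = measure_pmf.expectation (map_pmf ?ABC p) ?ratio"
    using finite_p by (intro integral_measure_pmf[symmetric]) auto
  also have "\<dots> = measure_pmf.expectation p (\<lambda>x. - log 2 (?P ?AC (?AC x)) + - log 2 (?P ?BC (?BC x))
      - - log 2 (?P ?ABC (?ABC x)) - - log 2 (?P C (C x)))"
    unfolding integral_map_pmf
  proof (intro integral_cong_AE AE_pmfI)
    fix x assume "x \<in> set_pmf p"
    then show "?ratio (?ABC x) = - log 2 (?P ?AC (?AC x)) + - log 2 (?P ?BC (?BC x))
        - - log 2 (?P ?ABC (?ABC x)) - - log 2 (?P C (C x))"
      using pmf_map_pos[of x p ?ABC] pmf_map_pos[of x p ?AC]
        pmf_map_pos[of x p ?BC] pmf_map_pos[of x p C]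
      by (simp add: log_divide log_mult)
  qed simp_all
  also have "\<dots> = pmf_entropy (map_pmf ?AC p) + pmf_entropy (map_pmf ?BC p)
      - pmf_entropy (map_pmf ?ABC p) - pmf_entropy (map_pmf C p)"
    by (simp only: pmf_entropy_map Bochner_Integration.integral_add Bochner_Integration.integral_diff
        Bochner_Integration.integrable_add Bochner_Integration.integrable_diff
        integrable_measure_pmf_finite[OF finite_p])
  finally show ?thesis .
qed

lemma cond_mutual_info_nonneg: "0 \<le> cond_mutual_info p A B C"
proof -
  interpret information_space "restrict_space (measure_pmf p) (set_pmf p)" 2
    by (rule information_space_restrict_set_pmf)
  show ?thesis
    using conditional_mutual_information_nonneg[of A B C, OF simple_function_restrict_set_pmf
        simple_function_restrict_set_pmf simple_function_restrict_set_pmf]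
    by (simp add: cond_mutual_info_def space_restrict_space)
qed

lemma cond_mutual_info_cong:
  assumes "\<And>x y. x \<in> set_pmf p \<Longrightarrow> y \<in> set_pmf p \<Longrightarrow> C x = C y \<longleftrightarrow> C' x = C' y"
    and "\<And>x y. x \<in> set_pmf p \<Longrightarrow> y \<in> set_pmf p \<Longrightarrow> C x = C y \<Longrightarrow> A x = A y \<longleftrightarrow> A' x = A' y"
    and "\<And>x y. x \<in> set_pmf p \<Longrightarrow> y \<in> set_pmf p \<Longrightarrow> C x = C y \<Longrightarrow> B x = B y \<longleftrightarrow> B' x = B' y"
  shows "cond_mutual_info p A B C = cond_mutual_info p A' B' C'"
proof -
  have "pmf_entropy (map_pmf (\<lambda>x. (A x, C x)) p) = pmf_entropy (map_pmf (\<lambda>x. (A' x, C' x)) p)"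
    "pmf_entropy (map_pmf (\<lambda>x. (B x, C x)) p) = pmf_entropy (map_pmf (\<lambda>x. (B' x, C' x)) p)"
    "pmf_entropy (map_pmf (\<lambda>x. (A x, B x, C x)) p) = pmf_entropy (map_pmf (\<lambda>x. (A' x, B' x, C' x)) p)"
    "pmf_entropy (map_pmf C p) = pmf_entropy (map_pmf C' p)"
    using assms by (intro pmf_entropy_map_cong; blast)+
  then show ?thesis
    by (simp add: cond_mutual_info_eq_entropy)
qed

lemma cond_mutual_info_commute: "cond_mutual_info p A B C = cond_mutual_info p B A C"
proof -
  have "pmf_entropy (map_pmf (\<lambda>x. (A x, B x, C x)) p) = pmf_entropy (map_pmf (\<lambda>x. (B x, A x, C x)) p)"
    by (intro pmf_entropy_map_cong) auto
  then show ?thesis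
    by (simp add: cond_mutual_info_eq_entropy)
qed

lemma cond_mutual_info_const: "cond_mutual_info p (\<lambda>_. a) B C = 0"
proof -
  have "pmf_entropy (map_pmf (\<lambda>x. (a, C x)) p) = pmf_entropy (map_pmf C p)"
    "pmf_entropy (map_pmf (\<lambda>x. (a, B x, C x)) p) = pmf_entropy (map_pmf (\<lambda>x. (B x, C x)) p)"
    by (intro pmf_entropy_map_cong; simp)+
  then show ?thesis
    by (simp add: cond_mutual_info_eq_entropy)
qed

lemma cond_mutual_info_chain:
  "cond_mutual_info p (\<lambda>x. (A x, S x)) B C
    = cond_mutual_info p S B C + cond_mutual_info p A B (\<lambda>x. (S x, C x))"
proof -
  have "pmf_entropy (map_pmf (\<lambda>x. ((A x, S x), C x)) p)
      = pmf_entropy (map_pmf (\<lambda>x. (A x, S x, C x)) p)"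
    "pmf_entropy (map_pmf (\<lambda>x. ((A x, S x), B x, C x)) p)
      = pmf_entropy (map_pmf (\<lambda>x. (A x, B x, S x, C x)) p)"
    "pmf_entropy (map_pmf (\<lambda>x. (B x, S x, C x)) p) = pmf_entropy (map_pmf (\<lambda>x. (S x, B x, C x)) p)"
    by (intro pmf_entropy_map_cong; auto)+
  then show ?thesis
    by (simp add: cond_mutual_info_eq_entropy)
qed

lemma cond_mutual_info_chain_right:
  "cond_mutual_info p A (\<lambda>x. (B x, S x)) C
    = cond_mutual_info p A S C + cond_mutual_info p A B (\<lambda>x. (S x, C x))"
  unfolding cond_mutual_info_commute[of A] by (rule cond_mutual_info_chain)

lemma cond_mutual_info_chain_sum:
  fixes pos :: "'i \<Rightarrow> 'o :: linorder" and f :: "'a \<Rightarrow> 'i \<Rightarrow> 'c"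
  assumes "finite T" "inj_on pos T"
  shows "(\<Sum>t\<in>T. cond_mutual_info p (\<lambda>x. f x t) B (\<lambda>x. (restrict (f x) {j\<in>T. pos j < pos t}, C x)))
    = cond_mutual_info p (\<lambda>x. restrict (f x) T) B C"
  using assms
proof (induction rule: finite_ranking_induct[where f = pos])
  case empty
  then show ?case
    by (simp add: restrict_def cond_mutual_info_const)
next
  case (insert u S)
  show ?case
  proof (cases "u \<in> S")
    case True
    then show ?thesis
      using insert by (simp add: insert_absorb)
  next
    case False
    have below_u: "pos y < pos u" if "y \<in> S" for y
      using insert.hyps(2)[OF that] inj_onD[OF insert.prems, of y u] False that
      by (auto simp: less_le)
    have pred_u: "{j \<in> insert u S. pos j < pos u} = S"
      using below_u by auto
    have pred: "{j \<in> insert u S. pos j < pos t} = {j \<in> S. pos j < pos t}" if "t \<in> S" for t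
      using below_u[OF that] by auto
    have "(\<Sum>t\<in>insert u S.
          cond_mutual_info p (\<lambda>x. f x t) B (\<lambda>x. (restrict (f x) {j\<in>insert u S. pos j < pos t}, C x)))
      = cond_mutual_info p (\<lambda>x. f x u) B (\<lambda>x. (restrict (f x) S, C x))
        + cond_mutual_info p (\<lambda>x. restrict (f x) S) B C"
      using insert.IH[OF inj_on_subset[OF insert.prems subset_insertI]]
      by (simp only: sum.insert[OF insert.hyps(1) False] pred_u pred cong: sum.cong)
    also have "\<dots> = cond_mutual_info p (\<lambda>x. (f x u, restrict (f x) S)) B C"
      by (simp add: cond_mutual_info_chain)
    also have "\<dots> = cond_mutual_info p (\<lambda>x. restrict (f x) (insert u S)) B C"
      by (intro cond_mutual_info_cong) (auto simp: fun_eq_iff restrict_def)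
    finally show ?thesis .
  qed
qed

lemma cond_mutual_info_indep:
  assumes "map_pmf (\<lambda>x. ((A x, C x), S x)) p = pair_pmf (map_pmf (\<lambda>x. (A x, C x)) p) (map_pmf S p)"
  shows "cond_mutual_info p A S C = 0"
proof -
  have "map_pmf (apfst snd) (map_pmf (\<lambda>x. ((A x, C x), S x)) p)
      = pair_pmf (map_pmf C p) (map_pmf S p)"
    unfolding assms pair_map_pmf1[symmetric] by (simp add: pmf.map_comp o_def)
  then have C_S: "map_pmf (\<lambda>x. (C x, S x)) p = pair_pmf (map_pmf C p) (map_pmf S p)"
    by (simp add: pmf.map_comp o_def)
  have "pmf_entropy (map_pmf (\<lambda>x. (A x, S x, C x)) p)
      = pmf_entropy (map_pmf (\<lambda>x. ((A x, C x), S x)) p)"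
    "pmf_entropy (map_pmf (\<lambda>x. (S x, C x)) p) = pmf_entropy (map_pmf (\<lambda>x. (C x, S x)) p)"
    by (intro pmf_entropy_map_cong; auto)+
  then show ?thesis
    using finite_p by (simp add: cond_mutual_info_eq_entropy assms C_S pmf_entropy_pair)
qed

text \<open>
  If \<open>S\<close> is independent of \<open>(A, C)\<close>, then conditioning on \<open>S\<close> costs nothing, and once \<open>S\<close> is given only
  the part of \<open>B\<close> that \<open>S\<close> does not determine matters.
\<close>

lemma cond_mutual_info_le_of_indep:
  assumes indep: "map_pmf (\<lambda>x. ((A x, C x), S x)) p
      = pair_pmf (map_pmf (\<lambda>x. (A x, C x)) p) (map_pmf S p)"
    and given_S: "\<And>x y. x \<in> set_pmf p \<Longrightarrow> y \<in> set_pmf p \<Longrightarrow> S x = S y \<Longrightarrow> B x = B y \<longleftrightarrow> B' x = B' y"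
  shows "cond_mutual_info p A B C \<le> cond_mutual_info p A B' (\<lambda>x. (S x, C x))"
proof -
  have "cond_mutual_info p A B C \<le> cond_mutual_info p A (\<lambda>x. (S x, B x)) C"
    by (simp add: cond_mutual_info_chain_right cond_mutual_info_nonneg)
  also have "\<dots> = cond_mutual_info p A (\<lambda>x. (B' x, S x)) C"
    using given_S by (intro cond_mutual_info_cong) auto
  also have "\<dots> = cond_mutual_info p A B' (\<lambda>x. (S x, C x))"
    by (simp add: cond_mutual_info_chain_right cond_mutual_info_indep[OF indep])
  finally show ?thesis .
qed

end

lemma cond_mutual_info_map_pmf:
  assumes "finite (set_pmf p)"
  shows "cond_mutual_info (map_pmf f p) A B C
      = cond_mutual_info p (\<lambda>x. A (f x)) (\<lambda>x. B (f x)) (\<lambda>x. C (f x))"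
  using assms by (simp add: cond_mutual_info_eq_entropy pmf.map_comp o_def)

lemma pmf_entropy_map_bind_pmf:
  assumes finite_m: "finite (set_pmf m)" and finite_q: "\<And>w. w \<in> set_pmf m \<Longrightarrow> finite (set_pmf (q w))"
    and tag_W: "\<And>w x. w \<in> set_pmf m \<Longrightarrow> x \<in> set_pmf (q w) \<Longrightarrow> W x = w"
  shows "pmf_entropy (map_pmf (\<lambda>x. (f x, W x)) (bind_pmf m q))
    = pmf_entropy m + measure_pmf.expectation m (\<lambda>w. pmf_entropy (map_pmf f (q w)))"
proof -
  have "map_pmf (\<lambda>x. (f x, W x)) (bind_pmf m q)
      = bind_pmf m (\<lambda>w. map_pmf (\<lambda>a. (a, w)) (map_pmf f (q w)))"
    unfolding map_bind_pmf pmf.map_comp using tag_W by (intro bind_pmf_cong map_pmf_cong) auto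
  then show ?thesis
    using finite_m finite_q by (simp add: pmf_entropy_bind_tagged)
qed

lemma cond_mutual_info_bind_pmf:
  assumes finite_m: "finite (set_pmf m)" and finite_q: "\<And>w. w \<in> set_pmf m \<Longrightarrow> finite (set_pmf (q w))"
    and tag_W: "\<And>w x. w \<in> set_pmf m \<Longrightarrow> x \<in> set_pmf (q w) \<Longrightarrow> W x = w"
    and kernel_C: "\<And>x y. C' x = C' y \<longleftrightarrow> C x = C y \<and> W x = W y"
  shows "cond_mutual_info (bind_pmf m q) A B C'
      = measure_pmf.expectation m (\<lambda>w. cond_mutual_info (q w) A B C)"
proof -
  let ?p = "bind_pmf m q"
  have finite_p: "finite (set_pmf ?p)"
    using finite_m finite_q by simp
  have "pmf_entropy (map_pmf (\<lambda>x. (A x, C' x)) ?p) = pmf_entropy (map_pmf (\<lambda>x. ((A x, C x), W x)) ?p)"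
    "pmf_entropy (map_pmf (\<lambda>x. (B x, C' x)) ?p) = pmf_entropy (map_pmf (\<lambda>x. ((B x, C x), W x)) ?p)"
    "pmf_entropy (map_pmf (\<lambda>x. (A x, B x, C' x)) ?p)
      = pmf_entropy (map_pmf (\<lambda>x. ((A x, B x, C x), W x)) ?p)"
    "pmf_entropy (map_pmf C' ?p) = pmf_entropy (map_pmf (\<lambda>x. (C x, W x)) ?p)"
    by (intro pmf_entropy_map_cong; auto simp: kernel_C)+
  then have "cond_mutual_info ?p A B C' = measure_pmf.expectation m (\<lambda>w.
      pmf_entropy (map_pmf (\<lambda>x. (A x, C x)) (q w)) + pmf_entropy (map_pmf (\<lambda>x. (B x, C x)) (q w))
      - pmf_entropy (map_pmf (\<lambda>x. (A x, B x, C x)) (q w)) - pmf_entropy (map_pmf C (q w)))"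
    by (simp add: cond_mutual_info_eq_entropy[OF finite_p] pmf_entropy_map_bind_pmf[OF finite_m
        finite_q tag_W]
        integrable_measure_pmf_finite finite_m)
  also have "\<dots> = measure_pmf.expectation m (\<lambda>w. cond_mutual_info (q w) A B C)"
    using finite_q by (intro integral_cong_AE AE_pmfI) (simp_all add: cond_mutual_info_eq_entropy)
  finally show ?thesis .
qed


section \<open>Product distributions\<close>

lemma Pi_pmf_pair:
  assumes "finite A"
  shows "Pi_pmf A (a, b) (\<lambda>x. pair_pmf (p x) (q x))
    = map_pmf (\<lambda>(f, g) x. (f x, g x)) (pair_pmf (Pi_pmf A a p) (Pi_pmf A b q))"
proof -
  have "Pi_pmf A (a, b) (\<lambda>x. pair_pmf (p x) (q x))
      = Pi_pmf A (a, b) (\<lambda>x. bind_pmf (p x) (\<lambda>y. bind_pmf (q x) (\<lambda>z. return_pmf (y, z))))"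
    by (simp add: pair_pmf_def)
  also have "\<dots> = do {f \<leftarrow> Pi_pmf A a p; g \<leftarrow> Pi_pmf A b q;
      return_pmf (\<lambda>x. if x \<in> A then (f x, g x) else (a, b))}"
    using assms by (subst Pi_pmf_bind[where d' = a], simp, subst Pi_pmf_bind[where d' = b]) simp_all
  also have "\<dots> = do {f \<leftarrow> Pi_pmf A a p; g \<leftarrow> Pi_pmf A b q; return_pmf (\<lambda>x. (f x, g x))}"
    using set_Pi_pmf_subset[OF assms, of a p] set_Pi_pmf_subset[OF assms, of b q]
    by (intro bind_pmf_cong refl arg_cong[where f=return_pmf]) fastforce
  also have "\<dots> = map_pmf (\<lambda>(f, g) x. (f x, g x)) (pair_pmf (Pi_pmf A a p) (Pi_pmf A b q))"
    by (simp add: pair_pmf_def map_bind_pmf)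
  finally show ?thesis .
qed

lemma Pi_pmf_map_dep:
  assumes "finite A" and "\<And>x. x \<notin> A \<Longrightarrow> f x d = d'"
  shows "Pi_pmf A d' (\<lambda>x. map_pmf (f x) (p x)) = map_pmf (\<lambda>g x. f x (g x)) (Pi_pmf A d p)"
proof -
  have "Pi_pmf A d' (\<lambda>x. map_pmf (f x) (p x))
      = do {g \<leftarrow> Pi_pmf A d p; return_pmf (\<lambda>x. if x \<in> A then f x (g x) else d')}"
    unfolding map_pmf_def using assms by (subst Pi_pmf_bind[where d' = d]) simp_all
  also have "\<dots> = do {g \<leftarrow> Pi_pmf A d p; return_pmf (\<lambda>x. f x (g x))}"
    using set_Pi_pmf_subset[OF assms(1), of d p] assms(2)
    by (intro bind_pmf_cong refl arg_cong[where f=return_pmf]) fastforce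
  finally show ?thesis
    by (simp add: map_pmf_def)
qed

lemma Pi_pmf_swap:
  assumes "finite A" "finite B"
  shows "map_pmf (\<lambda>f y x. f x y) (Pi_pmf A (\<lambda>_. d) (\<lambda>x. Pi_pmf B d (p x)))
    = Pi_pmf B (\<lambda>_. d) (\<lambda>y. Pi_pmf A d (\<lambda>x. p x y))"
  using assms(1)
proof (induction rule: finite_induct)
  case empty
  then show ?case
    using assms(2) by (simp add: Pi_pmf_return_pmf)
next
  case (insert a A)
  let ?upd = "\<lambda>(r, f). f(a := r)"
  let ?Q = "Pi_pmf A (\<lambda>_. d) (\<lambda>x. Pi_pmf B d (p x))"
    and ?R = "Pi_pmf B (\<lambda>_. d) (\<lambda>y. Pi_pmf A d (\<lambda>x. p x y))"
  have "map_pmf (\<lambda>f y x. f x y) (Pi_pmf (insert a A) (\<lambda>_. d) (\<lambda>x. Pi_pmf B d (p x)))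
     = map_pmf (\<lambda>(r, f) y. ?upd (r y, f y)) (pair_pmf (Pi_pmf B d (p a)) (map_pmf (\<lambda>f y x. f x y) ?Q))"
    using insert.hyps
    by (subst Pi_pmf_insert)
       (auto simp: pair_map_pmf2 pmf.map_comp o_def fun_eq_iff intro!: map_pmf_cong)
  also have "\<dots> = map_pmf (\<lambda>g y. ?upd (g y))
      (map_pmf (\<lambda>(f, g) x. (f x, g x)) (pair_pmf (Pi_pmf B d (p a)) ?R))"
    unfolding insert.IH pmf.map_comp by (intro map_pmf_cong) auto
  also have "\<dots> = map_pmf (\<lambda>g y. ?upd (g y))
      (Pi_pmf B (d, \<lambda>_. d) (\<lambda>y. pair_pmf (p a y) (Pi_pmf A d (\<lambda>x. p x y))))"
    by (simp only: Pi_pmf_pair assms(2))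
  also have "\<dots> = Pi_pmf B (\<lambda>_. d) (\<lambda>y. map_pmf ?upd (pair_pmf (p a y) (Pi_pmf A d (\<lambda>x. p x y))))"
    using assms(2) by (intro Pi_pmf_map_dep[symmetric]) (auto simp: fun_eq_iff)
  also have "\<dots> = Pi_pmf B (\<lambda>_. d) (\<lambda>y. Pi_pmf (insert a A) d (\<lambda>x. p x y))"
    using insert.hyps by (simp add: Pi_pmf_insert)
  finally show ?case .
qed

lemma Pi_pmf_overwrite:
  assumes "finite A" "B \<subseteq> A"
  shows "map_pmf (\<lambda>(f, g) x. if x \<in> B then f x else g x) (pair_pmf (Pi_pmf B d p) (Pi_pmf A d p))
      = Pi_pmf A d p"
proof -
  let ?rest = "\<lambda>g x. if x \<in> A - B then g x else d"
  have "Pi_pmf A d p = Pi_pmf (B \<union> (A - B)) d p"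
    using assms(2) by (simp add: Un_absorb1)
  also have "\<dots> = map_pmf (\<lambda>(f, g) x. if x \<in> B then f x else g x)
      (pair_pmf (Pi_pmf B d p) (map_pmf ?rest (Pi_pmf A d p)))"
    using assms finite_subset by (subst Pi_pmf_union) (auto simp: Pi_pmf_subset[of A "A - B"])
  also have "\<dots> = map_pmf (\<lambda>(f, g) x. if x \<in> B then f x else g x)
      (pair_pmf (Pi_pmf B d p) (Pi_pmf A d p))"
    unfolding pair_map_pmf2 pmf.map_comp
    by (intro map_pmf_cong refl)
       (auto simp: fun_eq_iff dest!: subsetD[OF set_Pi_pmf_subset[OF assms(1)]])
  finally show ?thesis ..
qed

lemma Pi_pmf_embed:
  assumes "finite A" "inj_on h {..<m::nat}" "h ` {..<m} \<subseteq> A"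
  shows "map_pmf (\<lambda>(f, g) x. if x \<in> h ` {..<m} then f (inv_into {..<m} h x) else g x)
      (pair_pmf (Pi_pmf {..<m} d (\<lambda>_. p)) (Pi_pmf A d (\<lambda>_. p))) = Pi_pmf A d (\<lambda>_. p)"
proof -
  let ?idx = "\<lambda>x. if x \<in> h ` {..<m} then inv_into {..<m} h x else m"
  have "bij_betw ?idx (h ` {..<m}) {..<m}"
    using bij_betw_inv_into[OF inj_on_imp_bij_betw[OF assms(2)]] by (simp cong: bij_betw_cong)
  then have "Pi_pmf (h ` {..<m}) d (\<lambda>_. p) = map_pmf (\<lambda>f. f \<circ> ?idx) (Pi_pmf {..<m} d (\<lambda>_. p))"
    by (intro Pi_pmf_bij_betw) simp_all
  then have "map_pmf (\<lambda>(f, g) x. if x \<in> h ` {..<m} then f x else g x)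
      (pair_pmf (Pi_pmf (h ` {..<m}) d (\<lambda>_. p)) (Pi_pmf A d (\<lambda>_. p)))
    = map_pmf (\<lambda>(f, g) x. if x \<in> h ` {..<m} then f (inv_into {..<m} h x) else g x)
      (pair_pmf (Pi_pmf {..<m} d (\<lambda>_. p)) (Pi_pmf A d (\<lambda>_. p)))"
    by (simp add: pair_map_pmf1 pmf.map_comp o_def case_prod_unfold cong: if_cong)
  then show ?thesis
    using Pi_pmf_overwrite[OF assms(1,3), of d "\<lambda>_. p"] by simp
qed

lemma Pi_pmf_indep:
  assumes "finite A" "K \<subseteq> A"
    and F_local: "\<And>f g. (\<And>x. x \<in> K \<Longrightarrow> f x = g x) \<Longrightarrow> F f = F g"
    and G_local: "\<And>f g. (\<And>x. x \<notin> K \<Longrightarrow> f x = g x) \<Longrightarrow> G f = G g"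
  shows "map_pmf (\<lambda>f. (F f, G f)) (Pi_pmf A d p)
      = pair_pmf (map_pmf F (Pi_pmf A d p)) (map_pmf G (Pi_pmf A d p))"
proof -
  let ?P = "pair_pmf (Pi_pmf K d p) (Pi_pmf A d p)"
  have merge: "map_pmf H (Pi_pmf A d p) = map_pmf (\<lambda>(f, g). H (\<lambda>x. if x \<in> K then f x else g x)) ?P"
    for H :: "('a \<Rightarrow> 'b) \<Rightarrow> 'e"
    by (subst Pi_pmf_overwrite[OF assms(1,2), symmetric])
        (simp add: pmf.map_comp o_def case_prod_unfold)
  have F_merge: "F (\<lambda>x. if x \<in> K then f x else g x) = F f" for f g
    by (rule F_local) simp
  have G_merge: "G (\<lambda>x. if x \<in> K then f x else g x) = G g" for f g
    by (rule G_local) simp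
  have "map_pmf F (Pi_pmf A d p) = map_pmf F (map_pmf fst ?P)"
    unfolding merge pmf.map_comp by (simp add: F_merge o_def case_prod_unfold)
  then have "map_pmf F (Pi_pmf A d p) = map_pmf F (Pi_pmf K d p)"
    by (simp add: map_fst_pair_pmf)
  moreover have "map_pmf (\<lambda>f. (F f, G f)) (Pi_pmf A d p) = map_pmf (\<lambda>(f, g). (F f, G g)) ?P"
    by (simp add: merge F_merge G_merge)
  ultimately show ?thesis
    by (simp add: map_pair)
qed

lemma prob_bind_pmf_ge:
  assumes "\<And>y. y \<in> set_pmf p \<Longrightarrow> c \<le> measure_pmf.prob (q y) E"
  shows "c \<le> measure_pmf.prob (bind_pmf p q) E"
proof -
  have "integrable p (\<lambda>y. measure_pmf.prob (q y) E)"
    by (intro measure_pmf.integrable_const_bound[where B=1]) auto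
  then have "(\<integral>y. c \<partial>p) \<le> (\<integral>y. measure_pmf.prob (q y) E \<partial>p)"
    using assms by (intro integral_mono_AE AE_pmfI) simp_all
  also have "\<dots> = measure_pmf.prob (bind_pmf p q) E"
    unfolding measure_pmf_bind
    by (subst measure_pmf.measure_bind[where N="count_space UNIV"])
        (simp_all add: measure_pmf_in_subprob_space)
  finally show ?thesis
    by simp
qed

text \<open>
  Coins are natural numbers, so additional coins of another type enter through an enumeration of
  their support.
\<close>

definition add_coins :: "nat pmf \<Rightarrow> 'a pmf \<Rightarrow> nat pmf" where
  "add_coins p q = map_pmf prod_encode (pair_pmf p (map_pmf (to_nat_on (set_pmf q)) q))"

definition base_coins :: "nat \<Rightarrow> nat" where
  "base_coins n = fst (prod_decode n)"

definition extra_coins :: "'a pmf \<Rightarrow> nat \<Rightarrow> 'a" where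
  "extra_coins q n = from_nat_into (set_pmf q) (snd (prod_decode n))"

lemma map_add_coins: "map_pmf (\<lambda>n. (base_coins n, extra_coins q n)) (add_coins p q) = pair_pmf p q"
proof -
  have "map_pmf (\<lambda>n. (base_coins n, extra_coins q n)) (add_coins p q)
      = map_pmf (\<lambda>(x, y). (x, from_nat_into (set_pmf q) (to_nat_on (set_pmf q) y))) (pair_pmf p q)"
    by (simp add: add_coins_def base_coins_def extra_coins_def pair_map_pmf2 pmf.map_comp o_def
        case_prod_unfold)
  also have "\<dots> = map_pmf id (pair_pmf p q)"
    by (intro map_pmf_cong) auto
  finally show ?thesis
    by simp
qed

lemma base_coins_0: "base_coins 0 = 0"
  by (simp add: base_coins_def prod_decode_def prod_decode_aux.simps)

lemma base_coins_in_set_pmf: "n \<in> set_pmf (add_coins p q) \<Longrightarrow> base_coins n \<in> set_pmf p"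
  by (auto simp: add_coins_def base_coins_def)

lemma extra_coins_in_set_pmf: "extra_coins q n \<in> set_pmf q"
  by (simp add: extra_coins_def from_nat_into set_pmf_not_empty)


section \<open>The columns before planting\<close>

type_synonym column = "bool \<times> nat \<times> (nat \<Rightarrow> bool)"
type_synonym columns = "nat \<Rightarrow> column"

definition M_of :: "columns \<Rightarrow> nat \<Rightarrow> bool" where
  [simp]: "M_of C j = fst (C j)"

definition Z_of :: "columns \<Rightarrow> nat \<Rightarrow> nat" where
  [simp]: "Z_of C j = fst (snd (C j))"

definition X_of :: "columns \<Rightarrow> matrix" where
  [simp]: "X_of C i j = snd (snd (C j)) i"

definition planted :: "nat \<Rightarrow> nat \<Rightarrow> columns \<Rightarrow> matrix" where
  "planted k w C i j = (if j = w then i < k else X_of C i j)"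

abbreviation default_column :: column where
  "default_column \<equiv> (False, 0, \<lambda>_. False)"

definition zeta_columns :: "nat \<Rightarrow> nat \<Rightarrow> columns pmf" where
  "zeta_columns k l = Pi_pmf {..<l} default_column (\<lambda>_. zeta_column k)"

abbreviation random_bits :: "nat \<Rightarrow> (nat \<Rightarrow> bool) pmf" where
  "random_bits n \<equiv> Pi_pmf {..<n} False (\<lambda>_. bernoulli_pmf (1/2))"

abbreviation random_matrix :: "nat \<Rightarrow> nat \<Rightarrow> matrix pmf" where
  "random_matrix k l \<equiv> Pi_pmf {..<k} (\<lambda>_. False) (\<lambda>_. random_bits l)"

definition zeta_entry :: "nat \<Rightarrow> bool \<Rightarrow> nat \<Rightarrow> nat \<Rightarrow> bool \<Rightarrow> bool" where
  "zeta_entry k m z i b \<longleftrightarrow> i < k \<and> i \<noteq> z \<and> (m \<or> b)"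

lemma zeta_column_eq:
  "zeta_column k = do {m \<leftarrow> bernoulli_pmf (1/3); z \<leftarrow> pmf_of_set {..<k}; u \<leftarrow> random_bits k;
     return_pmf (m, z, \<lambda>i. zeta_entry k m z i (u i))}"
proof -
  have "Pi_pmf {..<k} False
      (\<lambda>i. if i = z then return_pmf False else if m then return_pmf True else bernoulli_pmf (1/2))
      = map_pmf (\<lambda>u i. zeta_entry k m z i (u i)) (random_bits k)" for m z
  proof -
    have "zeta_entry k m z i =
      (if i < k \<and> i \<noteq> z then (if m then (\<lambda>_. True) else (\<lambda>b. b)) else (\<lambda>_. False))" for i
      by (auto simp: zeta_entry_def)
    then have "Pi_pmf {..<k} False
        (\<lambda>i. if i = z then return_pmf False else if m then return_pmf True else bernoulli_pmf (1/2))
        = Pi_pmf {..<k} False (\<lambda>i. map_pmf (zeta_entry k m z i) (bernoulli_pmf (1/2)))"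
      by (intro Pi_pmf_cong) auto
    also have "\<dots> = map_pmf (\<lambda>u i. zeta_entry k m z i (u i)) (random_bits k)"
      by (rule Pi_pmf_map_dep) (auto simp: zeta_entry_def)
    finally show ?thesis .
  qed
  then show ?thesis
    by (simp add: zeta_column_def map_pmf_def bind_assoc_pmf bind_return_pmf)
qed

lemma finite_set_zeta_columns:
  assumes "k > 0"
  shows "finite (set_pmf (zeta_columns k l))"
proof -
  have "finite (set_pmf (zeta_column k))"
    using assms by (auto simp: zeta_column_eq set_Pi_pmf lessThan_empty_iff intro!: finite_PiE_dflt)
  then show ?thesis
    by (auto simp: zeta_columns_def set_Pi_pmf)
qed

lemma zeta_columns_outside: "C \<in> set_pmf (zeta_columns k l) \<Longrightarrow> \<not> j < l \<Longrightarrow> C j = default_column"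
  by (auto simp: zeta_columns_def set_Pi_pmf PiE_dflt_def)

lemma X_of_zeta_columns_in_matrices:
  assumes C_in: "C \<in> set_pmf (zeta_columns k l)"
  shows "X_of C \<in> matrices k l"
proof -
  have "i < k" if "X_of C i j" "j < l" for i j
  proof -
    have "C j \<in> set_pmf (zeta_column k)"
      using C_in that(2) by (auto simp: zeta_columns_def set_Pi_pmf PiE_dflt_def)
    then show ?thesis
      using that(1) by (auto simp: zeta_column_eq zeta_entry_def)
  qed
  moreover have "j < l" if "X_of C i j" for i j
    using that zeta_columns_outside[OF C_in, of j] by (cases "j < l") auto
  ultimately show ?thesis
    by (auto simp: matrices_def)
qed

lemma planted_in_matrices:
  "C \<in> set_pmf (zeta_columns k l) \<Longrightarrow> w < l \<Longrightarrow> planted k w C \<in> matrices k l"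
  using X_of_zeta_columns_in_matrices[of C k l] by (auto simp: matrices_def planted_def)

lemma zeta_columns_zero_entry:
  assumes "C \<in> set_pmf (zeta_columns k l)" "j < l" "k > 0"
  shows "Z_of C j < k" "\<not> X_of C (Z_of C j) j"
proof -
  have "C j \<in> set_pmf (zeta_column k)"
    using assms(1,2) by (auto simp: zeta_columns_def set_Pi_pmf PiE_dflt_def)
  then show "Z_of C j < k" "\<not> X_of C (Z_of C j) j"
    using assms(3) by (auto simp: zeta_column_eq zeta_entry_def lessThan_empty_iff)
qed

definition redraw_column :: "nat \<Rightarrow> column \<Rightarrow> (nat \<Rightarrow> bool) \<Rightarrow> column" where
  "redraw_column k = (\<lambda>(m, z, x) u. (m, z, \<lambda>i. zeta_entry k m z i (u i)))"

definition redraw :: "nat \<Rightarrow> nat set \<Rightarrow> columns \<Rightarrow> matrix \<Rightarrow> columns" where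
  "redraw k A C V j = (if j \<in> A then redraw_column k (C j) (\<lambda>i. V i j) else C j)"

lemma map_redraw_column_zeta_column:
  "map_pmf (\<lambda>(c, u). redraw_column k c u) (pair_pmf (zeta_column k) (random_bits k)) = zeta_column k"
  by (simp add: redraw_column_def zeta_column_eq pair_pmf_def map_bind_pmf bind_assoc_pmf
      bind_return_pmf)

lemma map_redraw_zeta_columns:
  assumes "A \<subseteq> {..<l}"
  shows "map_pmf (\<lambda>(C, V). redraw k A C V) (pair_pmf (zeta_columns k l) (random_matrix k l))
    = zeta_columns k l"
proof -
  let ?f = "\<lambda>j (c, u). if j \<in> A then redraw_column k c u else c"
  have redraw_f: "map_pmf (?f j) (pair_pmf (zeta_column k) (random_bits k)) = zeta_column k" for j
    using map_redraw_column_zeta_column[of k] map_fst_pair_pmf[of "zeta_column k" "random_bits k"]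
    by (cases "j \<in> A") (simp_all add: case_prod_unfold)
  have "map_pmf (\<lambda>(C, V). redraw k A C V) (pair_pmf (zeta_columns k l) (random_matrix k l))
     = map_pmf (\<lambda>g j. ?f j (g j)) (map_pmf (\<lambda>(f, g) x. (f x, g x))
         (pair_pmf (zeta_columns k l) (map_pmf (\<lambda>V j i. V i j) (random_matrix k l))))"
    unfolding pair_map_pmf2 pmf.map_comp by (intro map_pmf_cong) (auto simp: redraw_def fun_eq_iff)
  also have "\<dots> = map_pmf (\<lambda>g j. ?f j (g j))
      (Pi_pmf {..<l} (default_column, \<lambda>_. False) (\<lambda>j. pair_pmf (zeta_column k) (random_bits k)))"
    unfolding zeta_columns_def by (simp only: Pi_pmf_swap Pi_pmf_pair finite_lessThan)
  also have "\<dots> = Pi_pmf {..<l} default_column (\<lambda>j. map_pmf (?f j) (pair_pmf (zeta_column k)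
      (random_bits k)))"
    using assms by (intro Pi_pmf_map_dep[symmetric]) auto
  also have "\<dots> = zeta_columns k l"
    unfolding redraw_f zeta_columns_def ..
  finally show ?thesis .
qed


section \<open>Executions\<close>

lemma view_append: "view i (g @ h) = view i g @ view i h"
  by (simp add: view_def)

lemma history_upto_mono: "set (history_upto P X c r n) \<subseteq> set (history_upto P X c r (n + m))"
  by (induction m) (auto simp: Let_def split: action.splits)

lemma length_transcript: "length (transcript P X c r) \<le> max_rounds P"
proof -
  have "length (history_upto P X c r n) \<le> n" for n
    by (induction n) (auto simp: Let_def split: action.splits)
  then show ?thesis
    by (simp add: transcript_def)
qed

definition execution :: "nat \<Rightarrow> nat \<Rightarrow> protocol \<Rightarrow> matrix \<Rightarrow> nat \<Rightarrow> (nat \<Rightarrow> nat) \<Rightarrow> bool" where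
  "execution k l P X c r \<longleftrightarrow>
     X \<in> matrices k l \<and> c \<in> set_pmf (coord_coins P) \<and> (\<forall>i<k. r i \<in> set_pmf (proc_coins P i))"

definition transcripts :: "nat \<Rightarrow> nat \<Rightarrow> protocol \<Rightarrow> history set" where
  "transcripts k l P = {transcript P X c r | X c r. execution k l P X c r}"

lemma
  assumes "is_protocol k l P" "execution k l P X c r"
  shows is_protocol_halts: "\<exists>b. coord_act P c (transcript P X c r) = Halt b"
    and is_protocol_addressees: "fst ` set (transcript P X c r) \<subseteq> {..<k}"
proof -
  have "(\<exists>b. coord_act P c (transcript P X c r) = Halt b) \<and> (\<forall>e \<in> set (transcript P X c r). fst e < k)"
    using assms unfolding is_protocol_def execution_def by fastforce
  then show "\<exists>b. coord_act P c (transcript P X c r) = Halt b" "fst ` set (transcript P X c r) \<subseteq> {..<k}"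
    by auto
qed

lemma is_protocol_Send_less:
  assumes "is_protocol k l P" "execution k l P X c r" and n_less: "n < max_rounds P"
    and sends: "coord_act P c (history_upto P X c r n) = Send i msg"
  shows "i < k"
proof -
  have "i \<in> fst ` set (history_upto P X c r (Suc n))"
    using sends by (simp add: Let_def)
  moreover have "set (history_upto P X c r (Suc n)) \<subseteq> set (transcript P X c r)"
    using history_upto_mono[of P X c r "Suc n" "max_rounds P - Suc n"] n_less
    by (simp add: transcript_def)
  moreover have "fst ` set (transcript P X c r) \<subseteq> {..<k}"
    by (rule is_protocol_addressees[OF assms(1,2)])
  ultimately show ?thesis
    by blast
qed

lemma finite_transcripts:
  assumes "is_protocol k l P"
  shows "finite (transcripts k l P)"
proof -
  obtain B where bounds: "\<And>X c r. execution k l P X c r \<Longrightarrow>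
      \<forall>(i, msg, msg') \<in> set (transcript P X c r). i < k \<and> length msg \<le> B \<and> length msg' \<le> B"
    using assms unfolding is_protocol_def execution_def by blast
  define messages where "messages = {msg :: message. set msg \<subseteq> UNIV \<and> length msg \<le> B}"
  have "transcripts k l P \<subseteq> {h. set h \<subseteq> {..<k} \<times> messages \<times> messages \<and> length h \<le> max_rounds P}"
  proof
    fix h assume "h \<in> transcripts k l P"
    then obtain X c r where h_eq: "h = transcript P X c r" and execution: "execution k l P X c r"
      unfolding transcripts_def by blast
    have "set h \<subseteq> {..<k} \<times> messages \<times> messages"
      using bounds[OF execution] unfolding h_eq messages_def by auto
    then show "h \<in> {h. set h \<subseteq> {..<k} \<times> messages \<times> messages \<and> length h \<le> max_rounds P}"
      by (simp add: h_eq length_transcript)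
  qed
  moreover have "finite {h :: history. set h \<subseteq> {..<k} \<times> messages \<times> messages \<and> length h \<le> max_rounds P}"
    unfolding messages_def by (intro finite_lists_length_le finite_cartesian_product) simp_all
  ultimately show ?thesis
    by (rule finite_subset)
qed

lemma is_protocolI:
  assumes finite: "finite (transcripts k l P)"
    and halts: "\<And>X c r. execution k l P X c r \<Longrightarrow> \<exists>b. coord_act P c (transcript P X c r) = Halt b"
    and addressees: "\<And>X c r. execution k l P X c r \<Longrightarrow> fst ` set (transcript P X c r) \<subseteq> {..<k}"
  shows "is_protocol k l P"
proof -
  define lengths where "lengths =
      (\<Union>h\<in>transcripts k l P. \<Union>(i, msg, msg')\<in>set h. {length msg, length msg'})"
  have "finite lengths"
    using finite by (auto simp: lengths_def)
  then obtain B where lengths_le: "n \<le> B" if "n \<in> lengths" for n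
    unfolding finite_nat_set_iff_bounded_le by blast
  have "i < k \<and> length msg \<le> B \<and> length msg' \<le> B"
    if execution: "execution k l P X c r"
      and entry: "(i, msg, msg') \<in> set (transcript P X c r)" for X c r i msg msg'
  proof -
    have "transcript P X c r \<in> transcripts k l P"
      using execution unfolding transcripts_def by blast
    then have "length msg \<in> lengths" "length msg' \<in> lengths"
      using entry unfolding lengths_def by blast+
    moreover have "fst (i, msg, msg') \<in> {..<k}"
      using addressees[OF execution] entry by blast
    ultimately show ?thesis
      by (simp add: lengths_le)
  qed
  then have "(\<exists>b. coord_act P c (transcript P X c r) = Halt b) \<and>
      (\<forall>(i, msg, msg') \<in> set (transcript P X c r). i < k \<and> length msg \<le> B \<and> length msg' \<le> B)"
    if "execution k l P X c r" for X c r
    using that halts by blast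
  then show ?thesis
    unfolding is_protocol_def execution_def by blast
qed

lemma finite_set_run:
  assumes protocol_P: "is_protocol k l P" and X_in: "X \<in> matrices k l"
  shows "finite (set_pmf (run k P X))"
proof (rule finite_subset)
  show "set_pmf (run k P X) \<subseteq> transcripts k l P \<times> range Halt"
  proof
    fix y assume "y \<in> set_pmf (run k P X)"
    then obtain c r where execution: "execution k l P X c r"
      and y_eq: "y = (transcript P X c r, coord_act P c (transcript P X c r))"
      using X_in by (auto simp: run_def Let_def execution_def set_Pi_pmf PiE_dflt_def)
    have "transcript P X c r \<in> transcripts k l P"
      using execution unfolding transcripts_def by blast
    moreover have "\<exists>b. coord_act P c (transcript P X c r) = Halt b"
      by (rule is_protocol_halts[OF protocol_P execution])
    ultimately show "y \<in> transcripts k l P \<times> range Halt"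
      unfolding y_eq by blast
  qed
  show "finite (transcripts k l P \<times> range Halt)"
    using finite_transcripts[OF protocol_P] by simp
qed


section \<open>Decomposing the cost by the planted column\<close>

definition joint_given :: "nat \<Rightarrow> nat \<Rightarrow> protocol \<Rightarrow> nat \<Rightarrow> (columns \<times> history) pmf" where
  "joint_given k l P w = do {C \<leftarrow> zeta_columns k l; (h, a) \<leftarrow> run k P (planted k w C);
    return_pmf (C, h)}"

lemma map_fst_joint_given: "map_pmf fst (joint_given k l P w) = zeta_columns k l"
  by (simp add: joint_given_def map_bind_pmf case_prod_unfold bind_return_pmf')

lemma joint_eq_bind_joint_given:
  "joint k l P = bind_pmf (pmf_of_set {..<l}) (\<lambda>w. map_pmf
     (\<lambda>(C, h). (planted k w C, M_of C, Z_of C, w, h)) (joint_given k l P w))"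
proof -
  have "joint k l P = do {C \<leftarrow> zeta_columns k l; w \<leftarrow> pmf_of_set {..<l};
      (h, a) \<leftarrow> run k P (planted k w C);
     return_pmf (planted k w C, M_of C, Z_of C, w, h)}"
    by (simp add: joint_def zeta_def zeta_columns_def bind_assoc_pmf bind_return_pmf
        planted_def[abs_def] M_of_def[abs_def] Z_of_def[abs_def])
  also have "\<dots> = do {w \<leftarrow> pmf_of_set {..<l}; C \<leftarrow> zeta_columns k l; (h, a) \<leftarrow> run k P (planted k w C);
     return_pmf (planted k w C, M_of C, Z_of C, w, h)}"
    by (rule bind_commute_pmf)
  finally show ?thesis
    by (simp add: joint_given_def map_bind_pmf case_prod_unfold)
qed

definition leakage ::
  "nat \<Rightarrow> nat \<Rightarrow> protocol \<Rightarrow> nat \<Rightarrow> nat \<Rightarrow> (columns \<Rightarrow> 'a) \<Rightarrow> (columns \<Rightarrow> 'b) \<Rightarrow> real" where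
  "leakage k l P w i F G =
     cond_mutual_info (joint_given k l P w) (\<lambda>(C, h). F C) (\<lambda>(C, h). view i h) (\<lambda>(C, h). G C)"

definition planted_cost :: "nat \<Rightarrow> nat \<Rightarrow> protocol \<Rightarrow> nat \<Rightarrow> real" where
  "planted_cost k l P w = (\<Sum>i<k.
     leakage k l P w i (\<lambda>C. drop_coord l w (M_of C)) (\<lambda>C. (planted k w C i, Z_of C))
   + leakage k l P w i (\<lambda>C. drop_coord l w (planted k w C i)) (\<lambda>C. (M_of C, Z_of C)))"

text \<open>
  The terms of column \<open>t\<close> in the two chain rules for \<^const>\<open>planted_cost\<close>, if \<open>A\<close> is the set of
  columns before \<open>t\<close>; the second chain rule runs in the opposite order.
\<close>

definition share :: "nat \<Rightarrow> nat \<Rightarrow> protocol \<Rightarrow> nat \<Rightarrow> nat \<Rightarrow> nat set \<Rightarrow> real" where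
  "share k l P w t A = (\<Sum>i<k.
     leakage k l P w i (\<lambda>C. M_of C t) (\<lambda>C. (restrict (M_of C) A, planted k w C i, Z_of C))
   + leakage k l P w i (\<lambda>C. planted k w C i t)
       (\<lambda>C. (restrict (planted k w C i) ({..<l} - {w, t} - A), M_of C, Z_of C)))"

context
  fixes k l :: nat and P :: protocol
  assumes k_pos: "k > 0" and protocol_P: "is_protocol k l P"
begin

lemma finite_set_joint_given:
  assumes "w < l"
  shows "finite (set_pmf (joint_given k l P w))"
  using finite_set_zeta_columns[OF k_pos] finite_set_run[OF protocol_P] planted_in_matrices[OF _
      assms]
  by (fastforce simp: joint_given_def)

lemma leakage_nonneg: "w < l \<Longrightarrow> 0 \<le> leakage k l P w i F G"
  unfolding leakage_def by (intro cond_mutual_info_nonneg finite_set_joint_given)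

lemma leakage_cong:
  assumes "w < l"
    and "\<And>C D. C \<in> set_pmf (zeta_columns k l) \<Longrightarrow> D \<in> set_pmf (zeta_columns k l) \<Longrightarrow>
        F C = F D \<longleftrightarrow> F' C = F' D"
    and "\<And>C D. C \<in> set_pmf (zeta_columns k l) \<Longrightarrow> D \<in> set_pmf (zeta_columns k l) \<Longrightarrow>
        G C = G D \<longleftrightarrow> G' C = G' D"
  shows "leakage k l P w i F G = leakage k l P w i F' G'"
  unfolding leakage_def
proof (intro cond_mutual_info_cong finite_set_joint_given assms(1))
  fix x y assume supp: "x \<in> set_pmf (joint_given k l P w)" "y \<in> set_pmf (joint_given k l P w)"
  obtain C g D h where xy: "x = (C, g)" "y = (D, h)"
    by (metis surj_pair)
  have "C \<in> set_pmf (zeta_columns k l)" "D \<in> set_pmf (zeta_columns k l)"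
    using supp by (force simp: xy simp flip: map_fst_joint_given[of k l P w])+
  then show "(case x of (C, h) \<Rightarrow> F C) = (case y of (C, h) \<Rightarrow> F C)
      \<longleftrightarrow> (case x of (C, h) \<Rightarrow> F' C) = (case y of (C, h) \<Rightarrow> F' C)"
    "(case x of (C, h) \<Rightarrow> G C) = (case y of (C, h) \<Rightarrow> G C)
      \<longleftrightarrow> (case x of (C, h) \<Rightarrow> G' C) = (case y of (C, h) \<Rightarrow> G' C)"
    using assms(2,3) by (simp_all add: xy)
qed simp

lemma leakage_chain_sum:
  fixes pos :: "nat \<Rightarrow> 'o :: linorder"
  assumes "w < l" "inj_on pos ({..<l} - {w})"
  shows "(\<Sum>t\<in>{..<l} - {w}.
      leakage k l P w i (\<lambda>C. F C t) (\<lambda>C. (restrict (F C) {j\<in>{..<l} - {w}. pos j < pos t}, G C)))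
    = leakage k l P w i (\<lambda>C. drop_coord l w (F C)) G"
  using cond_mutual_info_chain_sum[OF finite_set_joint_given[OF assms(1)] _ assms(2),
      of "\<lambda>(C, h). F C" "\<lambda>(C, h). view i h" "\<lambda>(C, h). G C"]
  by (simp add: leakage_def drop_coord_def case_prod_unfold)

lemma cond_mutual_info_joint:
  assumes "l > 0"
  shows "cond_mutual_info (joint k l P) (\<lambda>(X, M, Z, W, h). F X M W) (\<lambda>(X, M, Z, W, h). view i h)
      (\<lambda>(X, M, Z, W, h). (G X M, Z, W))
    = (\<Sum>w<l. leakage k l P w i (\<lambda>C. F (planted k w C) (M_of C) w)
        (\<lambda>C. (G (planted k w C) (M_of C), Z_of C))) / real l"
proof -
  define q where "q w = map_pmf (\<lambda>(C, h). (planted k w C, M_of C, Z_of C, w, h))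
      (joint_given k l P w)" for w
  let ?W = "\<lambda>(X, M, Z, W, h). W" and ?G = "\<lambda>(X, M, Z, W, h). (G X M, Z)"
  have nonempty: "{..<l} \<noteq> {}"
    using assms by auto
  have "cond_mutual_info (joint k l P) (\<lambda>(X, M, Z, W, h). F X M W) (\<lambda>(X, M, Z, W, h). view i h)
      (\<lambda>(X, M, Z, W, h). (G X M, Z, W))
    = measure_pmf.expectation (pmf_of_set {..<l}) (\<lambda>w. cond_mutual_info (q w)
        (\<lambda>(X, M, Z, W, h). F X M W) (\<lambda>(X, M, Z, W, h). view i h) ?G)"
    unfolding joint_eq_bind_joint_given q_def[symmetric]
    by (rule cond_mutual_info_bind_pmf[where W = ?W])
      (use nonempty in \<open>auto simp: q_def finite_set_joint_given\<close>)
  also have "\<dots> = (\<Sum>w<l. cond_mutual_info (q w)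
        (\<lambda>(X, M, Z, W, h). F X M W) (\<lambda>(X, M, Z, W, h). view i h) ?G) / real l"
    using nonempty by (simp add: integral_pmf_of_set)
  also have "\<dots> = (\<Sum>w<l. leakage k l P w i (\<lambda>C. F (planted k w C) (M_of C) w)
      (\<lambda>C. (G (planted k w C) (M_of C), Z_of C))) / real l"
    by (simp add: q_def leakage_def cond_mutual_info_map_pmf finite_set_joint_given case_prod_unfold)
  finally show ?thesis .
qed

lemma PIC_eq_average_planted_cost:
  assumes "l > 0"
  shows "PIC k l P = (\<Sum>w<l. planted_cost k l P w) / real l"
proof -
  have "PIC k l P = (\<Sum>i<k. \<Sum>w<l.
      leakage k l P w i (\<lambda>C. drop_coord l w (M_of C)) (\<lambda>C. (planted k w C i, Z_of C))
    + leakage k l P w i (\<lambda>C. drop_coord l w (planted k w C i)) (\<lambda>C. (M_of C, Z_of C))) / real l"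
    using cond_mutual_info_joint[OF assms, of "\<lambda>X M W. drop_coord l W M" _ "\<lambda>X M. X _"]
      cond_mutual_info_joint[OF assms, of "\<lambda>X M W. drop_coord l W (X _)" _ "\<lambda>X M. M"]
    by (simp add: PIC_def sum.distrib add_divide_distrib sum_divide_distrib)
  then show ?thesis
    unfolding planted_cost_def by (subst sum.swap) simp
qed

lemma PIC_nonneg: "l > 0 \<Longrightarrow> 0 \<le> PIC k l P"
  unfolding PIC_eq_average_planted_cost planted_cost_def
  by (intro divide_nonneg_nonneg sum_nonneg add_nonneg_nonneg leakage_nonneg) auto

lemma sum_share:
  fixes pos :: "nat \<Rightarrow> int"
  assumes w_less: "w < l" and inj_pos: "inj_on pos ({..<l} - {w})"
  shows "(\<Sum>t\<in>{..<l} - {w}. share k l P w t {j\<in>{..<l} - {w}. pos j < pos t}) = planted_cost k l P w"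
proof -
  let ?T = "{..<l} - {w}"
  have after: "{..<l} - {w, t} - {j\<in>?T. pos j < pos t} = {j\<in>?T. - pos j < - pos t}" if "t \<in> ?T" for t
    using inj_on_eq_iff[OF inj_pos _ that] by (force simp: less_le)
  have "inj_on (\<lambda>j. - pos j) ?T"
    using inj_pos by (simp add: inj_on_def)
  note backward = leakage_chain_sum[OF w_less this]
  have "(\<Sum>t\<in>?T. leakage k l P w i (\<lambda>C. planted k w C i t)
       (\<lambda>C. (restrict (planted k w C i) ({..<l} - {w, t} - {j\<in>?T. pos j < pos t}), M_of C, Z_of C)))
     = leakage k l P w i (\<lambda>C. drop_coord l w (planted k w C i)) (\<lambda>C. (M_of C, Z_of C))" for i
    unfolding backward[symmetric] by (intro sum.cong refl) (simp only: after)
  then show ?thesis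
    unfolding share_def planted_cost_def
    by (subst sum.swap) (simp only: sum.distrib leakage_chain_sum[OF w_less inj_pos])
qed

end


section \<open>Simulating a protocol on fewer columns\<close>

type_synonym hint = "(nat \<Rightarrow> bool) \<times> (nat \<Rightarrow> nat) \<times> (nat \<Rightarrow> bool)"

locale embedding =
  fixes k l m :: nat and col :: "nat \<Rightarrow> nat" and A :: "nat set" and P :: protocol
  assumes k_pos: "k > 0" and inj_col: "inj_on col {..<m}" and col_less: "col ` {..<m} \<subseteq> {..<l}"
    and A_subset: "A \<subseteq> {..<l} - col ` {..<m}" and protocol_P: "is_protocol k l P"
begin

definition hint :: "nat \<Rightarrow> columns \<Rightarrow> hint" where
  "hint i C = (restrict (M_of C) A, restrict (Z_of C) A,
    restrict (X_of C i) ({..<l} - col ` {..<m} - A))"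

definition hints :: "hint set" where
  "hints = (\<Union>i<k. hint i ` set_pmf (zeta_columns k l))"

definition encode_hint :: "hint \<Rightarrow> message" where
  "encode_hint H = replicate (to_nat_on hints H) True"

definition decode_hint :: "message \<Rightarrow> hint" where
  "decode_hint msg = from_nat_into hints (length msg)"

lemma finite_hints: "finite hints"
  using k_pos by (auto simp: hints_def finite_set_zeta_columns)

lemma hint_in_hints: "i < k \<Longrightarrow> C \<in> set_pmf (zeta_columns k l) \<Longrightarrow> hint i C \<in> hints"
  unfolding hints_def by blast

lemma decode_encode_hint: "H \<in> hints \<Longrightarrow> decode_hint (encode_hint H) = H"
  by (simp add: decode_hint_def encode_hint_def countable_finite finite_hints)

abbreviation slot :: "nat \<Rightarrow> nat" where
  "slot \<equiv> inv_into {..<m} col"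

definition filled_row :: "nat \<Rightarrow> (nat \<Rightarrow> bool) \<Rightarrow> hint \<Rightarrow> (nat \<Rightarrow> bool) \<Rightarrow> nat \<Rightarrow> bool" where
  "filled_row i x = (\<lambda>(M, Z, y) u j.
     if j \<in> col ` {..<m} then x (slot j)
     else if j \<in> A then zeta_entry k (M j) (Z j) i (u j)
     else j < l \<and> y j)"

definition filled :: "matrix \<Rightarrow> columns \<Rightarrow> matrix \<Rightarrow> matrix" where
  "filled X C V i = filled_row i (X i) (hint i C) (V i)"

lemma filled_apply:
  "filled X C V i j =
     (if j \<in> col ` {..<m} then X i (slot j)
      else if j \<in> A then zeta_entry k (M_of C j) (Z_of C j) i (V i j)
      else j < l \<and> X_of C i j)"
  by (auto simp: filled_def filled_row_def hint_def)

lemma filled_cong: "(\<And>i. i < k \<Longrightarrow> V i = V' i) \<Longrightarrow> filled X C V = filled X C V'"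
  by (auto simp: filled_apply zeta_entry_def fun_eq_iff)

lemma filled_in_matrices:
  assumes "X \<in> matrices k m" "C \<in> set_pmf (zeta_columns k l)"
  shows "filled X C V \<in> matrices k l"
  unfolding matrices_def
proof (intro CollectI allI impI)
  fix i j assume entry: "filled X C V i j"
  consider (input) "j \<in> col ` {..<m}" | (redrawn) "j \<notin> col ` {..<m}" "j \<in> A"
    | (sampled) "j \<notin> col ` {..<m}" "j \<notin> A"
    by blast
  then show "i < k \<and> j < l"
  proof cases
    case input
    then show ?thesis
      using entry assms(1) col_less by (auto simp: filled_apply matrices_def)
  next
    case redrawn
    then show ?thesis
      using entry A_subset by (auto simp: filled_apply zeta_entry_def)
  next
    case sampled
    then show ?thesis
      using entry X_of_zeta_columns_in_matrices[OF assms(2)] unfolding filled_apply matrices_def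
      by auto
  qed
qed

lemma Disj_filled:
  assumes C_in: "C \<in> set_pmf (zeta_columns k l)"
  shows "Disj k l (filled X C V) \<longleftrightarrow> Disj k m X"
proof -
  have "\<exists>i<k. \<not> filled X C V i j" if "j < l" "j \<notin> col ` {..<m}" for j
    using zeta_columns_zero_entry[OF C_in that(1) k_pos] that
    by (intro exI[of _ "Z_of C j"]) (simp add: filled_apply zeta_entry_def)
  then have "Disj k l (filled X C V) \<longleftrightarrow> (\<exists>j\<in>col ` {..<m}. \<forall>i<k. filled X C V i j)"
    unfolding Disj_def using col_less by blast
  also have "\<dots> \<longleftrightarrow> Disj k m X"
    by (auto simp: Disj_def filled_apply inj_col)
  finally show ?thesis .
qed

abbreviation drawn_columns :: "nat \<Rightarrow> columns" where
  "drawn_columns \<equiv> extra_coins (zeta_columns k l)"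

abbreviation drawn_bits :: "nat \<Rightarrow> nat \<Rightarrow> bool" where
  "drawn_bits \<equiv> extra_coins (random_bits l)"

definition sim :: protocol where
  "sim = \<lparr>coord_coins = add_coins (coord_coins P) (zeta_columns k l),
     proc_coins = \<lambda>i. add_coins (proc_coins P i) (random_bits l),
     coord_act = \<lambda>c h.
       if length h < k then Send (length h) (encode_hint (hint (length h) (drawn_columns c)))
       else coord_act P (base_coins c) (drop k h),
     proc_reply = \<lambda>i x r v msg.
       if v = [] then []
       else proc_reply P i (filled_row i x (decode_hint (fst (hd v))) (drawn_bits r))
         (base_coins r) (tl v) msg,
     max_rounds = k + max_rounds P\<rparr>"

definition prelude :: "columns \<Rightarrow> history" where
  "prelude C = map (\<lambda>i. (i, encode_hint (hint i C), [])) [0..<k]"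

lemma view_prelude:
  assumes "i < k"
  shows "view i (prelude C) = [(encode_hint (hint i C), [])]"
proof -
  have "view i (map (\<lambda>i. (i, encode_hint (hint i C), [])) [0..<n])
      = (if i < n then [(encode_hint (hint i C), [])] else [])" for n
    by (induction n) (auto simp: view_def less_Suc_eq)
  then show ?thesis
    using assms by (simp add: prelude_def)
qed

lemma coord_act_sim:
  "coord_act sim c (prelude C @ h) = coord_act P (base_coins c) h"
  by (simp add: sim_def prelude_def)

lemma proc_reply_sim:
  assumes "i < k" "C \<in> set_pmf (zeta_columns k l)"
  shows "proc_reply sim i (X i) (r i) (view i (prelude C @ h)) msg
    = proc_reply P i (filled X C (\<lambda>i. drawn_bits (r i)) i) (base_coins (r i)) (view i h) msg"
  using assms by (simp add: sim_def view_append view_prelude decode_encode_hint hint_in_hints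
      filled_def)

lemma history_upto_sim_prelude:
  assumes "n \<le> k"
  shows "history_upto sim X c r n
    = map (\<lambda>i. (i, encode_hint (hint i (drawn_columns c)), [])) [0..<n]"
  using assms
proof (induction n)
  case (Suc n)
  have "view n (map (\<lambda>i. (i, encode_hint (hint i (drawn_columns c)), [])) [0..<n]) = []"
    by (auto simp: view_def filter_empty_conv)
  then show ?case
    using Suc by (simp add: sim_def Let_def)
qed simp

context
  fixes X :: matrix and c :: nat and r :: "nat \<Rightarrow> nat"
  assumes execution: "execution k m sim X c r"
begin

private abbreviation (input) "X' \<equiv> filled X (drawn_columns c) (\<lambda>i. drawn_bits (r i))"

lemma execution_sim: "execution k l P X' (base_coins c) (\<lambda>i. base_coins (r i))"
  using execution filled_in_matrices[OF _ extra_coins_in_set_pmf]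
  by (auto simp: execution_def sim_def intro: base_coins_in_set_pmf)

lemma history_upto_sim:
  assumes "n \<le> max_rounds P"
  shows "history_upto sim X c r (k + n)
    = prelude (drawn_columns c) @ history_upto P X' (base_coins c) (\<lambda>i. base_coins (r i)) n"
  using assms
proof (induction n)
  case 0
  then show ?case
    by (simp add: history_upto_sim_prelude prelude_def)
next
  case (Suc n)
  let ?h = "history_upto P X' (base_coins c) (\<lambda>i. base_coins (r i)) n"
  show ?case
  proof (cases "coord_act P (base_coins c) ?h")
    case (Halt b)
    then show ?thesis
      using Suc by (simp add: Let_def coord_act_sim)
  next
    case (Send i msg)
    have "i < k"
      using is_protocol_Send_less[OF protocol_P execution_sim _ Send] Suc.prems by simp
    then have "proc_reply sim i (X i) (r i) (view i (prelude (drawn_columns c) @ ?h)) msg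
        = proc_reply P i (X' i) (base_coins (r i)) (view i ?h) msg"
      by (intro proc_reply_sim extra_coins_in_set_pmf)
    then show ?thesis
      using Suc Send by (simp add: Let_def coord_act_sim)
  qed
qed

lemma transcript_sim:
  "transcript sim X c r = prelude (drawn_columns c) @ transcript P X' (base_coins c)
    (\<lambda>i. base_coins (r i))"
  using history_upto_sim[of "max_rounds P"] by (simp add: transcript_def sim_def)

end

lemma is_protocol_sim: "is_protocol k m sim"
proof (rule is_protocolI)
  have "transcripts k m sim
      \<subseteq> (\<lambda>(C, h). prelude C @ h) ` (set_pmf (zeta_columns k l) \<times> transcripts k l P)"
    using execution_sim extra_coins_in_set_pmf by (fastforce simp: transcripts_def transcript_sim)
  then show "finite (transcripts k m sim)"
    using finite_transcripts[OF protocol_P] finite_set_zeta_columns[OF k_pos]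
    by (auto intro: finite_subset)
next
  fix X c r assume execution: "execution k m sim X c r"
  show "\<exists>b. coord_act sim c (transcript sim X c r) = Halt b"
    using is_protocol_halts[OF protocol_P execution_sim[OF execution]]
    by (simp add: transcript_sim[OF execution] coord_act_sim)
  have "fst ` set (prelude C) \<subseteq> {..<k}" for C
    by (auto simp: prelude_def)
  then show "fst ` set (transcript sim X c r) \<subseteq> {..<k}"
    using is_protocol_addressees[OF protocol_P execution_sim[OF execution]]
    by (simp add: transcript_sim[OF execution] image_Un)
qed

definition split_coins :: "nat \<Rightarrow> nat \<Rightarrow> nat \<times> (nat \<Rightarrow> bool)" where
  "split_coins i n = (if i < k then (base_coins n, drawn_bits n) else (0, \<lambda>_. False))"

lemma map_split_coins_proc_coins_sim:
  "map_pmf (\<lambda>r. (\<lambda>i. fst (split_coins i (r i)), \<lambda>i. snd (split_coins i (r i))))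
    (Pi_pmf {..<k} 0 (proc_coins sim))
    = pair_pmf (Pi_pmf {..<k} 0 (proc_coins P)) (random_matrix k l)"
proof -
  have "Pi_pmf {..<k} (0, \<lambda>_. False) (\<lambda>i. pair_pmf (proc_coins P i) (random_bits l))
      = Pi_pmf {..<k} (0, \<lambda>_. False) (\<lambda>i. map_pmf (split_coins i) (proc_coins sim i))"
    by (intro Pi_pmf_cong) (simp_all add: sim_def split_coins_def[abs_def] flip: map_add_coins)
  also have "\<dots> = map_pmf (\<lambda>r i. split_coins i (r i)) (Pi_pmf {..<k} 0 (proc_coins sim))"
    by (rule Pi_pmf_map_dep) (simp_all add: split_coins_def)
  finally have "map_pmf (\<lambda>r i. split_coins i (r i)) (Pi_pmf {..<k} 0 (proc_coins sim))
      = map_pmf (\<lambda>(r, V) i. (r i, V i)) (pair_pmf (Pi_pmf {..<k} 0 (proc_coins P)) (random_matrix k l))"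
    by (simp only: Pi_pmf_pair finite_lessThan)
  from arg_cong[OF this, of "map_pmf (\<lambda>g. (\<lambda>i. fst (g i), \<lambda>i. snd (g i)))"] show ?thesis
    by (simp add: pmf.map_comp o_def case_prod_unfold)
qed

lemma map_split_coord_coins_sim:
  "map_pmf (\<lambda>c. (base_coins c, drawn_columns c)) (coord_coins sim)
    = pair_pmf (coord_coins P) (zeta_columns k l)"
  by (simp add: sim_def map_add_coins)

lemma transcript_sim_split_coins:
  assumes "X \<in> matrices k m" "c \<in> set_pmf (coord_coins sim)"
    "r \<in> set_pmf (Pi_pmf {..<k} 0 (proc_coins sim))"
  shows "transcript sim X c r = prelude (drawn_columns c) @
    transcript P (filled X (drawn_columns c) (\<lambda>i. snd (split_coins i (r i)))) (base_coins c)
      (\<lambda>i. fst (split_coins i (r i)))"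
proof -
  have "(\<lambda>i. base_coins (r i)) = (\<lambda>i. fst (split_coins i (r i)))"
    using assms(3) by (auto simp: set_Pi_pmf PiE_dflt_def base_coins_0 split_coins_def)
  moreover have "filled X C (\<lambda>i. drawn_bits (r i)) = filled X C (\<lambda>i. snd (split_coins i (r i)))" for C
    by (rule filled_cong) (simp add: split_coins_def)
  moreover have "transcript sim X c r = prelude (drawn_columns c) @
      transcript P (filled X (drawn_columns c) (\<lambda>i. drawn_bits (r i)))
        (base_coins c) (\<lambda>i. base_coins (r i))"
    using assms by (intro transcript_sim) (auto simp: execution_def set_Pi_pmf PiE_dflt_def)
  ultimately show ?thesis
    by simp
qed

lemma run_sim:
  assumes "X \<in> matrices k m"
  shows "run k sim X = do {C \<leftarrow> zeta_columns k l; V \<leftarrow> random_matrix k l;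
    map_pmf (\<lambda>(h, a). (prelude C @ h, a)) (run k P (filled X C V))}"
proof -
  let ?coins = "Pi_pmf {..<k} 0 (proc_coins P)"
  define outcome where
    "outcome C V c r =
      (let h = transcript P (filled X C V) c r in (prelude C @ h, coord_act P c h))" for C V c r
  have "run k sim X = do {c \<leftarrow> coord_coins sim; r \<leftarrow> Pi_pmf {..<k} 0 (proc_coins sim);
      return_pmf (outcome (drawn_columns c) (\<lambda>i. snd (split_coins i (r i)))
        (base_coins c) (\<lambda>i. fst (split_coins i (r i))))}"
    unfolding run_def
    by (intro bind_pmf_cong refl arg_cong[where f = return_pmf])
       (simp add: transcript_sim_split_coins assms outcome_def Let_def coord_act_sim)
  also have "\<dots> = do {(c, C) \<leftarrow> pair_pmf (coord_coins P) (zeta_columns k l);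
      (r, V) \<leftarrow> pair_pmf ?coins (random_matrix k l);
      return_pmf (outcome C V c r)}"
    by (simp add: bind_map_pmf flip: map_split_coord_coins_sim map_split_coins_proc_coins_sim)
  also have "\<dots> = do {c \<leftarrow> coord_coins P; C \<leftarrow> zeta_columns k l; r \<leftarrow> ?coins; V \<leftarrow> random_matrix k l;
      return_pmf (outcome C V c r)}"
    by (simp add: pair_pmf_def bind_assoc_pmf bind_return_pmf)
  also have "\<dots> = do {C \<leftarrow> zeta_columns k l; V \<leftarrow> random_matrix k l; c \<leftarrow> coord_coins P; r \<leftarrow> ?coins;
      return_pmf (outcome C V c r)}"
    by (simp only: bind_commute_pmf[of ?coins "random_matrix k l"]
        bind_commute_pmf[of "coord_coins P" "random_matrix k l"]
        bind_commute_pmf[of "coord_coins P" "zeta_columns k l"])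
  also have "\<dots> = do {C \<leftarrow> zeta_columns k l; V \<leftarrow> random_matrix k l;
      map_pmf (\<lambda>(h, a). (prelude C @ h, a)) (run k P (filled X C V))}"
    by (simp add: run_def outcome_def map_pmf_def bind_assoc_pmf bind_return_pmf Let_def)
  finally show ?thesis .
qed

lemma sim_in_delta_error_protocols:
  assumes "P \<in> delta_error_protocols \<delta> k l (Disj k l)"
  shows "sim \<in> delta_error_protocols \<delta> k m (Disj k m)"
proof -
  have "1 - \<delta> \<le> measure_pmf.prob (run k sim X) {(h, a). a = Halt (Disj k m X)}"
    if X_in: "X \<in> matrices k m" for X
    unfolding run_sim[OF X_in]
  proof (intro prob_bind_pmf_ge)
    fix C V assume C_in: "C \<in> set_pmf (zeta_columns k l)"
    have "1 - \<delta> \<le> measure_pmf.prob (run k P (filled X C V))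
        {(h, a). a = Halt (Disj k l (filled X C V))}"
      using assms filled_in_matrices[OF X_in C_in] by (auto simp: delta_error_protocols_def)
    then show "1 - \<delta> \<le> measure_pmf.prob (map_pmf (\<lambda>(h, a). (prelude C @ h, a)) (run k P (filled X C V)))
        {(h, a). a = Halt (Disj k m X)}"
      by (simp add: vimage_def Disj_filled[OF C_in] case_prod_unfold)
  qed
  then show ?thesis
    using is_protocol_sim by (simp add: delta_error_protocols_def)
qed

definition place_columns :: "columns \<Rightarrow> columns \<Rightarrow> columns" where
  "place_columns C' C j = (if j \<in> col ` {..<m} then C' (slot j) else C j)"

definition pick_columns :: "columns \<Rightarrow> columns" where
  "pick_columns D j = (if j < m then D (col j) else default_column)"

lemma filled_planted:
  assumes "w < m" "C \<in> set_pmf (zeta_columns k l)"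
  shows "filled (planted k w C') C V = planted k (col w) (place_columns C' (redraw k A C V))"
proof (intro ext)
  fix i j
  have "slot j = w \<longleftrightarrow> j = col w" if "j \<in> col ` {..<m}"
    using that inj_col assms(1) by (auto simp: inj_on_eq_iff)
  moreover have "C j = default_column" if "\<not> j < l"
    by (rule zeta_columns_outside[OF assms(2) that])
  ultimately show "filled (planted k w C') C V i j
    = planted k (col w) (place_columns C' (redraw k A C V)) i j"
    using assms(1) A_subset
    by (auto simp: filled_apply planted_def place_columns_def redraw_def redraw_column_def
        case_prod_unfold)
qed

lemma pick_place_columns:
  assumes "C' \<in> set_pmf (zeta_columns k m)"
  shows "pick_columns (place_columns C' C) = C'"
  using zeta_columns_outside[OF assms]
  by (auto simp: pick_columns_def place_columns_def inj_col fun_eq_iff)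

lemma prelude_place_columns_redraw: "prelude (place_columns C' (redraw k A C V)) = prelude C"
proof -
  have "hint i (place_columns C' (redraw k A C V)) = hint i C" for i
    using A_subset
    by (auto simp: hint_def place_columns_def redraw_def redraw_column_def case_prod_unfold
        fun_eq_iff restrict_def)
  then show ?thesis
    by (simp add: prelude_def)
qed

lemma map_place_columns_zeta_columns:
  "map_pmf (\<lambda>(C', C). place_columns C' C) (pair_pmf (zeta_columns k m) (zeta_columns k l))
    = zeta_columns k l"
  using Pi_pmf_embed[OF finite_lessThan inj_col col_less]
  by (simp add: zeta_columns_def place_columns_def[abs_def])

lemma joint_given_sim:
  assumes w_less: "w < m"
  shows "joint_given k m sim w
    = map_pmf (\<lambda>(D, h). (pick_columns D, prelude D @ h)) (joint_given k l P (col w))"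
proof -
  let ?V = "random_matrix k l"
  define outcome where "outcome D =
      map_pmf (\<lambda>(h, a). (pick_columns D, prelude D @ h)) (run k P (planted k (col w) D))" for D
  have "joint_given k m sim w = do {C' \<leftarrow> zeta_columns k m; C \<leftarrow> zeta_columns k l; V \<leftarrow> ?V;
     map_pmf (\<lambda>(h, a). (C', prelude C @ h)) (run k P (filled (planted k w C') C V))}"
    unfolding joint_given_def
    by (intro bind_pmf_cong refl)
       (simp add: run_sim planted_in_matrices w_less bind_assoc_pmf bind_map_pmf map_pmf_def
         bind_return_pmf case_prod_unfold)
  also have "\<dots> = do {C' \<leftarrow> zeta_columns k m; C \<leftarrow> zeta_columns k l; V \<leftarrow> ?V;
      outcome (place_columns C' (redraw k A C V))}"
    unfolding outcome_def
    by (intro bind_pmf_cong refl)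
       (simp add: filled_planted w_less pick_place_columns prelude_place_columns_redraw)
  also have "\<dots> = do {C' \<leftarrow> zeta_columns k m;
      C \<leftarrow> map_pmf (\<lambda>(C, V). redraw k A C V) (pair_pmf (zeta_columns k l) ?V);
     outcome (place_columns C' C)}"
    by (simp add: pair_pmf_def map_pmf_def bind_assoc_pmf bind_return_pmf)
  also have "\<dots> = do {D \<leftarrow> map_pmf (\<lambda>(C', C). place_columns C' C) (pair_pmf (zeta_columns k m) (zeta_columns k l));
      outcome D}"
    using A_subset by (subst map_redraw_zeta_columns)
        (auto simp: pair_pmf_def map_pmf_def bind_assoc_pmf bind_return_pmf)
  also have "\<dots> = do {D \<leftarrow> zeta_columns k l; outcome D}"
    unfolding map_place_columns_zeta_columns ..
  also have "\<dots> = map_pmf (\<lambda>(D, h). (pick_columns D, prelude D @ h)) (joint_given k l P (col w))"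
    by (simp add: outcome_def joint_given_def map_bind_pmf case_prod_unfold map_pmf_def
        bind_assoc_pmf bind_return_pmf)
  finally show ?thesis .
qed

lemma joint_given_pick_columns_indep:
  assumes S_outside: "\<And>C D. (\<And>j. j \<notin> col ` {..<m} \<Longrightarrow> C j = D j) \<Longrightarrow> S C = S D"
  shows "map_pmf (\<lambda>x. (H (pick_columns (fst x)), S (fst x))) (joint_given k l P w)
    = pair_pmf (map_pmf (\<lambda>x. H (pick_columns (fst x))) (joint_given k l P w))
        (map_pmf (\<lambda>x. S (fst x)) (joint_given k l P w))"
proof -
  have pick: "pick_columns C = pick_columns D" if "\<And>j. j \<in> col ` {..<m} \<Longrightarrow> C j = D j" for C D
    using that by (auto simp: pick_columns_def fun_eq_iff)
  have "map_pmf (\<lambda>D. (H (pick_columns D), S D)) (zeta_columns k l)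
      = pair_pmf (map_pmf (\<lambda>D. H (pick_columns D)) (zeta_columns k l)) (map_pmf S (zeta_columns k l))"
    unfolding zeta_columns_def
  proof (rule Pi_pmf_indep[where K = "col ` {..<m}"])
    show "H (pick_columns C) = H (pick_columns D)" if "\<And>j. j \<in> col ` {..<m} \<Longrightarrow> C j = D j" for C D
      by (simp only: pick[OF that])
  qed (fact finite_lessThan, fact col_less, fact S_outside)
  then show ?thesis
    unfolding map_fst_joint_given[of k l P w, symmetric] by (simp add: pmf.map_comp o_def)
qed

lemma leakage_sim_le:
  assumes w_less: "w < m" and i_less: "i < k"
    and S_outside: "\<And>C D. (\<And>j. j \<notin> col ` {..<m} \<Longrightarrow> C j = D j) \<Longrightarrow> S C = S D"
    and S_hint: "\<And>C D. S C = S D \<Longrightarrow> hint i C = hint i D"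
  shows "leakage k m sim w i F G
    \<le> leakage k l P (col w) i (\<lambda>D. F (pick_columns D)) (\<lambda>D. (S D, G (pick_columns D)))"
proof -
  let ?p = "joint_given k l P (col w)"
  have finite_p: "finite (set_pmf ?p)"
    using w_less col_less by (intro finite_set_joint_given[OF k_pos protocol_P]) auto
  have view: "view i (prelude C @ g) = view i (prelude D @ h) \<longleftrightarrow> view i g = view i h"
    if "S C = S D" for C D g h
    by (simp add: view_append view_prelude i_less S_hint[OF that])
  have "leakage k m sim w i F G = cond_mutual_info ?p (\<lambda>x. F (pick_columns (fst x)))
      (\<lambda>x. view i (prelude (fst x) @ snd x)) (\<lambda>x. G (pick_columns (fst x)))"
    by (simp add: leakage_def joint_given_sim w_less cond_mutual_info_map_pmf finite_p
        case_prod_unfold)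
  also have "\<dots> \<le> cond_mutual_info ?p (\<lambda>x. F (pick_columns (fst x))) (\<lambda>x. view i (snd x))
      (\<lambda>x. (S (fst x), G (pick_columns (fst x))))"
  proof (rule cond_mutual_info_le_of_indep[OF finite_p])
    show "map_pmf (\<lambda>x. ((F (pick_columns (fst x)), G (pick_columns (fst x))), S (fst x))) ?p
      = pair_pmf (map_pmf (\<lambda>x. (F (pick_columns (fst x)), G (pick_columns (fst x)))) ?p)
          (map_pmf (\<lambda>x. S (fst x)) ?p)"
      by (rule joint_given_pick_columns_indep[where H = "\<lambda>D. (F D, G D)", OF S_outside])
  qed (rule view)
  finally show ?thesis
    by (simp add: leakage_def case_prod_unfold)
qed

end


section \<open>Two columns\<close>

lemma restrict_eq_iff: "restrict f S = restrict g S \<longleftrightarrow> (\<forall>x\<in>S. f x = g x)"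
  by (auto simp: fun_eq_iff restrict_def)

lemma drop_coord_eq_iff:
  "{..<l} - {w} = {w'} \<Longrightarrow> drop_coord l w f = drop_coord l w g \<longleftrightarrow> f w' = g w'"
  by (simp add: drop_coord_def restrict_eq_iff)

locale pair_embedding = embedding k l 2 col A P
  for k l :: nat and col :: "nat \<Rightarrow> nat" and A :: "nat set" and P :: protocol +
  fixes w w' :: nat
  assumes range_two: "{..<2} = {w, w'}" and w_neq: "w \<noteq> w'"
begin

abbreviation "planted_col \<equiv> col w"
abbreviation "other_col \<equiv> col w'"

lemma less_two_iff: "j < 2 \<longleftrightarrow> j = w \<or> j = w'"
  using range_two lessThan_iff[of j 2] by simp

lemma w_less: "w < 2"
  by (simp add: less_two_iff)

lemma col_image: "col ` {..<2} = {planted_col, other_col}"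
  by (simp add: range_two)

lemma other_col_neq: "other_col \<noteq> planted_col"
  using inj_onD[OF inj_col, of w' w] w_neq by (auto simp: less_two_iff)

lemma planted_col_less: "planted_col < l"
  using col_less unfolding col_image by simp

lemma drop_coord_two_eq_iff: "drop_coord 2 w f = drop_coord 2 w g \<longleftrightarrow> f w' = g w'"
  using range_two w_neq by (intro drop_coord_eq_iff) auto

lemma eq_iff_pick_columns_eq:
  "(\<lambda>j. f (C j)) = (\<lambda>j. f (D j))
    \<longleftrightarrow> (\<forall>j\<in>- col ` {..<2}. f (C j) = f (D j)) \<and> (\<lambda>j. f (pick_columns C j)) = (\<lambda>j. f (pick_columns D j))"
proof -
  have "(\<lambda>j. f (pick_columns C j)) = (\<lambda>j. f (pick_columns D j))
      \<longleftrightarrow> f (C planted_col) = f (D planted_col) \<and> f (C other_col) = f (D other_col)"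
    by (auto simp: pick_columns_def fun_eq_iff less_two_iff)
  moreover have "(\<forall>j. Q j) \<longleftrightarrow> (\<forall>j\<in>- col ` {..<2}. Q j) \<and> Q planted_col \<and> Q other_col" for Q
    unfolding col_image by blast
  ultimately show ?thesis
    by (simp only: fun_eq_iff[of "\<lambda>j. f (C j)"])
qed

lemmas M_of_eq_iff = eq_iff_pick_columns_eq[of fst, folded M_of_def M_of_def[abs_def]]
  and Z_of_eq_iff = eq_iff_pick_columns_eq[of "\<lambda>c. fst (snd c)", folded Z_of_def Z_of_def[abs_def]]

lemma planted_pick_columns_eq_iff:
  "planted k w (pick_columns C) i = planted k w (pick_columns D) i
    \<longleftrightarrow> X_of C i other_col = X_of D i other_col"
  using w_neq by (auto simp: pick_columns_def planted_def fun_eq_iff less_two_iff)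

lemma pick_columns_other: "pick_columns C w' = C other_col"
  by (simp add: pick_columns_def less_two_iff)

lemma M_leakage_sim_le:
  assumes i_less: "i < k"
  shows "leakage k 2 sim w i (\<lambda>C. drop_coord 2 w (M_of C)) (\<lambda>C. (planted k w C i, Z_of C))
    \<le> leakage k l P planted_col i (\<lambda>C. M_of C other_col)
        (\<lambda>C. (restrict (M_of C) A, planted k planted_col C i, Z_of C))"
proof -
  define S where "S C =
      (restrict (M_of C) A, restrict (Z_of C) (- col ` {..<2}), restrict (X_of C i) (- col ` {..<2}))" for C
  have "leakage k 2 sim w i (\<lambda>C. drop_coord 2 w (M_of C)) (\<lambda>C. (planted k w C i, Z_of C))
    \<le> leakage k l P planted_col i (\<lambda>C. drop_coord 2 w (M_of (pick_columns C)))
        (\<lambda>C. (S C, planted k w (pick_columns C) i, Z_of (pick_columns C)))"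
    using A_subset by (intro leakage_sim_le w_less i_less)
        (force simp: S_def hint_def restrict_eq_iff)+
  also have "\<dots> = leakage k l P planted_col i (\<lambda>C. M_of C other_col)
      (\<lambda>C. (restrict (M_of C) A, planted k planted_col C i, Z_of C))"
  proof (rule leakage_cong[OF k_pos protocol_P planted_col_less])
    show "drop_coord 2 w (M_of (pick_columns C)) = drop_coord 2 w (M_of (pick_columns D))
        \<longleftrightarrow> M_of C other_col = M_of D other_col" for C D
      by (simp add: drop_coord_two_eq_iff pick_columns_other)
    show "(S C, planted k w (pick_columns C) i, Z_of (pick_columns C))
        = (S D, planted k w (pick_columns D) i, Z_of (pick_columns D))
        \<longleftrightarrow> (restrict (M_of C) A, planted k planted_col C i, Z_of C)
          = (restrict (M_of D) A, planted k planted_col D i, Z_of D)" for C D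
    proof -
      have "planted k planted_col C i = planted k planted_col D i
          \<longleftrightarrow> (\<forall>j\<in>- col ` {..<2}. X_of C i j = X_of D i j) \<and> X_of C i other_col = X_of D i other_col"
        using other_col_neq unfolding col_image by (auto simp: planted_def fun_eq_iff)
      then show ?thesis
        by (simp only: S_def prod.inject restrict_eq_iff
            planted_pick_columns_eq_iff Z_of_eq_iff[of C D] conj_ac)
    qed
  qed
  finally show ?thesis .
qed

lemma X_leakage_sim_le:
  assumes i_less: "i < k"
  shows "leakage k 2 sim w i (\<lambda>C. drop_coord 2 w (planted k w C i)) (\<lambda>C. (M_of C, Z_of C))
    \<le> leakage k l P planted_col i (\<lambda>C. planted k planted_col C i other_col)
        (\<lambda>C. (restrict (planted k planted_col C i) ({..<l} - {planted_col, other_col} - A),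
          M_of C, Z_of C))"
proof -
  define S where "S C = (restrict (X_of C i) ({..<l} - col ` {..<2} - A),
    restrict (M_of C) (- col ` {..<2}), restrict (Z_of C) (- col ` {..<2}))" for C
  have "leakage k 2 sim w i (\<lambda>C. drop_coord 2 w (planted k w C i)) (\<lambda>C. (M_of C, Z_of C))
    \<le> leakage k l P planted_col i (\<lambda>C. drop_coord 2 w (planted k w (pick_columns C) i))
        (\<lambda>C. (S C, M_of (pick_columns C), Z_of (pick_columns C)))"
    using A_subset by (intro leakage_sim_le w_less i_less)
        (force simp: S_def hint_def restrict_eq_iff)+
  also have "\<dots> = leakage k l P planted_col i (\<lambda>C. planted k planted_col C i other_col)
        (\<lambda>C. (restrict (planted k planted_col C i) ({..<l} - {planted_col, other_col} - A),
          M_of C, Z_of C))"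
  proof (rule leakage_cong[OF k_pos protocol_P planted_col_less])
    show "drop_coord 2 w (planted k w (pick_columns C) i)
        = drop_coord 2 w (planted k w (pick_columns D) i)
        \<longleftrightarrow> planted k planted_col C i other_col = planted k planted_col D i other_col" for C D
      using w_neq other_col_neq by (simp add: drop_coord_two_eq_iff pick_columns_other planted_def)
    show "(S C, M_of (pick_columns C), Z_of (pick_columns C))
        = (S D, M_of (pick_columns D), Z_of (pick_columns D))
        \<longleftrightarrow> (restrict (planted k planted_col C i) ({..<l} - {planted_col, other_col} - A), M_of C, Z_of C)
          = (restrict (planted k planted_col D i) ({..<l} - {planted_col, other_col} - A),
            M_of D, Z_of D)" for C D
    proof -
      have "restrict (planted k planted_col C i) ({..<l} - {planted_col, other_col} - A)
          = restrict (X_of C i) ({..<l} - col ` {..<2} - A)" for C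
        unfolding col_image by (auto simp: planted_def fun_eq_iff restrict_def)
      then show ?thesis
        by (simp only: S_def prod.inject restrict_eq_iff[of "M_of _"] restrict_eq_iff[of "Z_of _"]
            M_of_eq_iff[of C D] Z_of_eq_iff[of C D] conj_ac)
    qed
  qed
  finally show ?thesis .
qed

lemma planted_cost_sim_le: "planted_cost k 2 sim w \<le> share k l P planted_col other_col A"
  unfolding planted_cost_def share_def
  by (intro sum_mono add_mono M_leakage_sim_le X_leakage_sim_le) simp_all

end

lemma PIC_two_column_sim_le:
  assumes "embedding k l 2 col A P"
  shows "PIC k 2 (embedding.sim k l 2 col A P)
      \<le> (share k l P (col 0) (col 1) A + share k l P (col 1) (col 0) A) / 2"
proof -
  interpret embedding k l 2 col A P
    by (rule assms)
  have range_two: "{..<2::nat} = {0, 1}"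
    by auto
  have "planted_cost k 2 sim 0 \<le> share k l P (col 0) (col 1) A"
    by (intro pair_embedding.planted_cost_sim_le pair_embedding.intro pair_embedding_axioms.intro
        assms) auto
  moreover have "planted_cost k 2 sim 1 \<le> share k l P (col 1) (col 0) A"
    by (intro pair_embedding.planted_cost_sim_le pair_embedding.intro pair_embedding_axioms.intro
        assms) auto
  moreover have "PIC k 2 sim = (planted_cost k 2 sim 0 + planted_cost k 2 sim 1) / 2"
    using PIC_eq_average_planted_cost[OF k_pos is_protocol_sim] by (simp add: range_two)
  ultimately show ?thesis
    by simp
qed


section \<open>Averaging over pairs of columns\<close>

definition cyc_pos :: "nat \<Rightarrow> nat \<Rightarrow> nat \<Rightarrow> int" where
  "cyc_pos l s j = (if s \<le> j then int j - int s else int j - int s + int l)"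

definition cyc_arc :: "nat \<Rightarrow> nat \<Rightarrow> nat \<Rightarrow> nat set" where
  "cyc_arc l s t = {j\<in>{..<l} - {s}. cyc_pos l s j < cyc_pos l s t}"

lemma inj_on_cyc_pos: "s < l \<Longrightarrow> inj_on (cyc_pos l s) {..<l}"
  by (auto simp: inj_on_def cyc_pos_def split: if_splits)

lemma cyc_arc_backwards:
  assumes "s < l" "t < l" "s \<noteq> t"
  shows "cyc_arc l s t = {j\<in>{..<l} - {t}. - cyc_pos l t j < - cyc_pos l t s}"
  using assms by (auto simp: cyc_arc_def cyc_pos_def split: if_splits)

abbreviation pair_sim :: "nat \<Rightarrow> nat \<Rightarrow> protocol \<Rightarrow> nat \<Rightarrow> nat \<Rightarrow> protocol" where
  "pair_sim k l P s t \<equiv> embedding.sim k l 2 (\<lambda>j. if j = 0 then s else t) (cyc_arc l s t) P"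

lemma embedding_cyc_arc:
  assumes "k > 0" "is_protocol k l P" "s < l" "t < l" "s \<noteq> t"
  shows "embedding k l 2 (\<lambda>j. if j = 0 then s else t) (cyc_arc l s t) P"
  using assms by unfold_locales (auto simp: inj_on_def less_2_cases_iff cyc_arc_def)

context
  fixes k l :: nat and P :: protocol
  assumes k_pos: "k > 0" and protocol_P: "is_protocol k l P"
begin

lemma sum_share_cyc_arc:
  assumes "s < l"
  shows "(\<Sum>t\<in>{..<l} - {s}. share k l P s t (cyc_arc l s t)) = planted_cost k l P s"
  unfolding cyc_arc_def using assms
  by (intro sum_share[OF k_pos protocol_P] inj_on_subset[OF inj_on_cyc_pos]) auto

lemma sum_share_cyc_arc_backwards:
  assumes "t < l"
  shows "(\<Sum>s\<in>{..<l} - {t}. share k l P t s (cyc_arc l s t)) = planted_cost k l P t"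
proof -
  have "inj_on (\<lambda>j. - cyc_pos l t j) ({..<l} - {t})"
    using inj_on_cyc_pos[OF assms] by (simp add: inj_on_def)
  then show ?thesis
    using assms by (simp add: cyc_arc_backwards flip: sum_share[OF k_pos protocol_P assms])
qed

lemma sum_PIC_pair_sim_le:
  assumes "l > 0"
  shows "(\<Sum>s<l. \<Sum>t\<in>{..<l} - {s}. PIC k 2 (pair_sim k l P s t)) \<le> real l * PIC k l P"
proof -
  have "(\<Sum>s<l. \<Sum>t\<in>{..<l} - {s}. PIC k 2 (pair_sim k l P s t))
      \<le> (\<Sum>s<l. \<Sum>t\<in>{..<l} - {s}.
        (share k l P s t (cyc_arc l s t) + share k l P t s (cyc_arc l s t)) / 2)"
    using PIC_two_column_sim_le[OF embedding_cyc_arc[OF k_pos protocol_P]]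
    by (intro sum_mono) fastforce
  also have "\<dots> = ((\<Sum>s<l. \<Sum>t\<in>{..<l} - {s}. share k l P s t (cyc_arc l s t))
      + (\<Sum>s<l. \<Sum>t\<in>{..<l} - {s}. share k l P t s (cyc_arc l s t))) / 2"
    by (simp add: sum.distrib flip: sum_divide_distrib)
  also have "(\<Sum>s<l. \<Sum>t\<in>{..<l} - {s}. share k l P t s (cyc_arc l s t))
      = (\<Sum>t<l. \<Sum>s\<in>{..<l} - {t}. share k l P t s (cyc_arc l s t))"
    using sum.swap_restrict[of "{..<l}" "{..<l}" "\<lambda>s t. share k l P t s (cyc_arc l s t)"
        "\<lambda>s t. s \<noteq> t"]
    by (simp add: set_diff_eq eq_commute)
  finally show ?thesis
    using assms
    by (simp add: sum_share_cyc_arc sum_share_cyc_arc_backwards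
        PIC_eq_average_planted_cost[OF k_pos protocol_P])
qed

lemma ex_pair_sim_PIC_le:
  assumes "l > 1"
  obtains s t where "s < l" "t < l" "s \<noteq> t" "(real l - 1) * PIC k 2 (pair_sim k l P s t) \<le> PIC k l P"
proof (rule ccontr)
  assume "\<not> thesis"
  with that have all_large: "PIC k l P / (real l - 1) < PIC k 2 (pair_sim k l P s t)"
    if "s < l" "t < l" "s \<noteq> t" for s t
    using that assms by (force simp: pos_divide_less_eq mult.commute)
  have "real l * PIC k l P = (\<Sum>s<l. \<Sum>t\<in>{..<l} - {s}. PIC k l P / (real l - 1))"
    using assms by (simp add: of_nat_diff)
  also have "\<dots> < (\<Sum>s<l. \<Sum>t\<in>{..<l} - {s}. PIC k 2 (pair_sim k l P s t))"
  proof (intro sum_strict_mono all_large)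
    show "{..<l} - {s} \<noteq> {}" for s
      using assms card_mono[of "{s}" "{..<l}"] by auto
  qed (use assms in auto)
  also have "\<dots> \<le> real l * PIC k l P"
    using assms by (intro sum_PIC_pair_sim_le) simp
  finally show False
    by simp
qed

end

lemma mult_PIC_inf_two_le_PIC:
  assumes k_pos: "k > 0" and "l > 1" and delta_error: "P \<in> delta_error_protocols \<delta> k l (Disj k l)"
  shows "ereal (real l - 1) * PIC_inf \<delta> k 2 (Disj k 2) \<le> ereal (PIC k l P)"
proof -
  have protocol_P: "is_protocol k l P"
    using delta_error by (simp add: delta_error_protocols_def)
  obtain s t where pair: "s < l" "t < l" "s \<noteq> t"
    and cheap: "(real l - 1) * PIC k 2 (pair_sim k l P s t) \<le> PIC k l P"
    by (rule ex_pair_sim_PIC_le[OF k_pos protocol_P \<open>l > 1\<close>])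
  have "PIC_inf \<delta> k 2 (Disj k 2) \<le> ereal (PIC k 2 (pair_sim k l P s t))"
    unfolding PIC_inf_def
    by (intro INF_lower embedding.sim_in_delta_error_protocols[OF embedding_cyc_arc] k_pos
        protocol_P pair delta_error)
  then have "ereal (real l - 1) * PIC_inf \<delta> k 2 (Disj k 2)
      \<le> ereal (real l - 1) * ereal (PIC k 2 (pair_sim k l P s t))"
    using \<open>l > 1\<close> by (intro ereal_mult_left_mono) simp_all
  also have "\<dots> \<le> ereal (PIC k l P)"
    using cheap by simp
  finally show ?thesis .
qed

theorem theorem3:
  fixes k l :: nat and \<delta> :: real
  assumes "k \<ge> 2" and "l \<ge> 1" and "0 \<le> \<delta>" and "\<delta> < 1"
  shows "PIC_inf \<delta> k l (Disj k l) \<ge> ereal (real l - 1) * PIC_inf \<delta> k 2 (Disj k 2)"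
  unfolding PIC_inf_def[of \<delta> k l]
proof (rule INF_greatest)
  fix P assume delta_error: "P \<in> delta_error_protocols \<delta> k l (Disj k l)"
  show "ereal (real l - 1) * PIC_inf \<delta> k 2 (Disj k 2) \<le> ereal (PIC k l P)"
  proof (cases "l = 1")
    case True
    have "0 \<le> PIC k l P"
      using delta_error assms by (intro PIC_nonneg) (simp_all add: delta_error_protocols_def)
    then show ?thesis
      using True by (simp flip: zero_ereal_def)
  next
    case False
    then show ?thesis
      using assms delta_error by (intro mult_PIC_inf_two_le_PIC) simp_all
  qed
qed

end
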